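(* Let $\mathfrak{g}=\mathfrak{g}_{\bar 0}+\mathfrak{g}_{\bar 1}$ be a real Lie superalgebra with $\mathfrak{g}_{\bar 0}$ reductive, $\mathfrak{g}_{\bar 0}=\mathfrak{k}_0\oplus\mathfrak{k}_1\oplus\cdots\oplus\mathfrak{k}_s$ with $\mathfrak{k}_0$ Abelian and $\mathfrak{k}_1,\dots,\mathfrak{k}_s$ simple ideals. Let $\mathbf{B}$ be a bi-invariant metric on $\mathfrak{g}$, let $x_0,\dots,x_s\in\mathbb{R}\setminus\{0\}$, and let $$\langle\cdot,\cdot\rangle=x_0\mathbf{B}|_{\mathfrak{k}_0}+x_1\mathbf{B}|_{\mathfrak{k}_1}+\cdots+x_s\mathbf{B}|_{\mathfrak{k}_s}+\mathbf{B}|_{\mathfrak{g}_{\bar 1}}.$$ Let $\mathbf{K}$ be the Killing form of $\mathfrak{g}$, $\mathbf{K}_i$ the Killing form of the Lie algebra $\mathfrak{k}_i$, $l_i$ the index of the representation of $\mathfrak{k}_i$ on $\mathfrak{g}_{\bar 1}$ ($1\le i\le s$), and $\mathcal{C}_{\mathbf{B}|_{\mathfrak{k}_i}}$ the Casimir operator of $\mathfrak{k}_i$ on $\mathfrak{g}_{\bar 1}$ with respect to $\mathbf{B}|_{\mathfrak{k}_i}$ ($0\le i\le s$). Then the Ricci tensor of $(\mathfrak{g},\langle\cdot,\cdot\rangle)$ is given by $$\mathrm{ric}(X,Y)=\begin{cases}-\frac{x_0^2}{4}\mathbf{K}(X,Y), & X,Y\in\mathfrak{k}_0;\\ \frac14(l_ix_i^2-1)\mathbf{K}_i(X,Y),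 & X,Y\in\mathfrak{k}_i,\ 1\le i\le s;\\ \sum_{i=0}^{s}\left(\frac{x_i}{2}-1\right)\mathbf{B}\big(X,\mathcal{C}_{\mathbf{B}|_{\mathfrak{k}_i}}(Y)\big), & X,Y\in\mathfrak{g}_{\bar 1};\\ 0, & \text{otherwise,}\end{cases}$$ where "otherwise" means that $X$ and $Y$ lie in two different ones of the subspaces $\mathfrak{k}_0,\mathfrak{k}_1,\dots,\mathfrak{k}_s,\mathfrak{g}_{\bar 1}$.
   Context: Lie superalgebras are finite dimensional with $\mathfrak{g}_{\bar 1}\ne 0$; $[X]\in\mathbb{Z}_2$ is the parity of a homogeneous element $X$, and formulas are written for homogeneous elements. A metric on $\mathfrak{g}$ is a non-degenerate bilinear form $f$ that is even ($f(\mathfrak{g}_{\bar 0},\mathfrak{g}_{\bar 1})=0$) and supersymmetric ($f(X,Y)=(-1)^{[X][Y]}f(Y,X)$). It is bi-invariant if $f([X,Y],Z)=f(X,[Y,Z])$. For a bi-invariant metric $\mathbf{B}$ the ideals $\mathfrak{k}_i$ are pairwise $\mathbf{B}$-orthogonal and each $\mathbf{B}|_{\mathfrak{k}_i}$ is non-degenerate. Killing form: $\mathbf{K}(X,Y)=\mathrm{str}(\mathrm{ad}X\circ\mathrm{ad}Y)$, where $\mathrm{str}$ is the supertrace (trace of the even-even block minus trace of the odd-odd block). Index: for a simple Lie algebra $\mathfrak{k}_i\subset\mathfrak{g}_{\bar 0}$ acting on $\mathfrak{g}_{\bar 1}$ by $\mathrm{ad}$, the index $l_i\in\mathbb{R}$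 is the constant with $\mathrm{tr}(\mathrm{ad}X\circ\mathrm{ad}Y|_{\mathfrak{g}_{\bar 1}})=l_i\mathbf{K}_i(X,Y)$ for all $X,Y\in\mathfrak{k}_i$. Casimir operator: $\mathcal{C}_{\mathbf{B}|_{\mathfrak{k}_i}}=\sum_j(\mathrm{ad}\,e_j\circ\mathrm{ad}\,e_j^* )|_{\mathfrak{g}_{\bar 1}}$, where $\{e_j\}$ is a basis of $\mathfrak{k}_i$ and $\{e_j^*\}\subset\mathfrak{k}_i$ is the dual basis, $\mathbf{B}(e_j,e_k^* )=\delta_{jk}$ (it is $0$ if $\mathfrak{k}_i=0$). The Levi-Civita connection $\nabla$ of a metric is the unique even bilinear map with $\langle\nabla_XY,Z\rangle+(-1)^{[X][Y]}\langle Y,\nabla_XZ\rangle=0$ and $\nabla_XY-(-1)^{[X][Y]}\nabla_YX=[X,Y]$. The curvature is $R(X,Y)Z=\nabla_X\nabla_YZ-(-1)^{[X][Y]}\nabla_Y\nabla_XZ-\nabla_{[X,Y]}Z$, and $\mathrm{ric}(X,Y)=\mathrm{str}(Z\mapsto R(Z,X)Y)$. *)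

theory Defs
  imports "HOL-Analysis.Analysis" "HOL-Library.Z2"
begin

section \<open>Direct sums and traces\<close>

definition direct_sum :: "'i set \<Rightarrow> ('i \<Rightarrow> 'a::real_vector set) \<Rightarrow> 'a set \<Rightarrow> bool" where
  "direct_sum I V W \<longleftrightarrow>
     finite I \<and> subspace W \<and> (\<forall>i\<in>I. subspace (V i) \<and> V i \<subseteq> W) \<and>
     (\<forall>X\<in>W. \<exists>!u. u \<in> (\<Pi>\<^sub>E i\<in>I. V i) \<and> X = (\<Sum>i\<in>I. u i))"

text \<open>The component of \<open>X\<close> in the summand \<open>V i\<close>; meaningful for \<open>X\<close> in the direct sum of
  the family \<open>V\<close>.\<close>

definition component :: "'i set \<Rightarrow> ('i \<Rightarrow> 'a::real_vector set) \<Rightarrow> 'i \<Rightarrow> 'a \<Rightarrow> 'a" where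
  "component I V i X = (THE u. u \<in> (\<Pi>\<^sub>E i\<in>I. V i) \<and> X = (\<Sum>i\<in>I. u i)) i"

definition some_basis :: "'a::real_vector set \<Rightarrow> 'a set" where
  "some_basis V = (SOME E. independent E \<and> span E = V)"

text \<open>The trace of a linear map \<open>f\<close> that sends the finite-dimensional subspace \<open>V\<close> into itself.\<close>

definition trace_on :: "'a::real_vector set \<Rightarrow> ('a \<Rightarrow> 'a) \<Rightarrow> real" where
  "trace_on V f = (let E = some_basis V in \<Sum>e\<in>E. representation E (f e) e)"


section \<open>Lie superalgebras\<close>

text \<open>Parities are elements of \<^typ>\<open>bit\<close>, the field with two elements. \<open>G 0\<close> and \<open>G 1\<close> are the even
  and the odd part of a Lie superalgebra whose underlying vector space is the whole type.
  The zero vector has both parities; every formula for homogeneous elements is consistent with this.\<close>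

definition ssgn :: "bit \<Rightarrow> bit \<Rightarrow> real" where
  "ssgn p q = (if p * q = 1 then - 1 else 1)"

locale lie_superalgebra =
  fixes G :: "bit \<Rightarrow> 'a::real_vector set"
    and br :: "'a \<Rightarrow> 'a \<Rightarrow> 'a"
  assumes finite_dimensional: "\<exists>S::'a set. finite S \<and> span S = UNIV"
    and grading: "direct_sum {0, 1} G UNIV"
    and odd_part_nonzero: "G 1 \<noteq> {0}"
    and bilinear_br: "bilinear br"
    and br_parity: "\<And>p q X Y. X \<in> G p \<Longrightarrow> Y \<in> G q \<Longrightarrow> br X Y \<in> G (p + q)"
    and br_skew: "\<And>p q X Y. X \<in> G p \<Longrightarrow> Y \<in> G q \<Longrightarrow> br X Y = - (ssgn p q *\<^sub>R br Y X)"
    and br_jacobi: "\<And>p q r X Y Z. X \<in> G p \<Longrightarrow> Y \<in> G q \<Longrightarrow> Z \<in> G r \<Longrightarrow>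
          br X (br Y Z) = br (br X Y) Z + ssgn p q *\<^sub>R br Y (br X Z)"

abbreviation part :: "(bit \<Rightarrow> 'a::real_vector set) \<Rightarrow> bit \<Rightarrow> 'a \<Rightarrow> 'a" where
  "part G p X \<equiv> component {0, 1} G p X"

definition supertrace :: "(bit \<Rightarrow> 'a::real_vector set) \<Rightarrow> ('a \<Rightarrow> 'a) \<Rightarrow> real" where
  "supertrace G f = trace_on (G 0) (\<lambda>Z. part G 0 (f Z)) - trace_on (G 1) (\<lambda>Z. part G 1 (f Z))"

definition super_killing ::
    "(bit \<Rightarrow> 'a::real_vector set) \<Rightarrow> ('a \<Rightarrow> 'a \<Rightarrow> 'a) \<Rightarrow> 'a \<Rightarrow> 'a \<Rightarrow> real" where
  "super_killing G br X Y = supertrace G (\<lambda>Z. br X (br Y Z))"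

definition super_metric ::
    "(bit \<Rightarrow> 'a::real_vector set) \<Rightarrow> ('a \<Rightarrow> 'a \<Rightarrow> real) \<Rightarrow> bool" where
  "super_metric G f \<longleftrightarrow>
     bilinear f \<and>
     (\<forall>X\<in>G 0. \<forall>Y\<in>G 1. f X Y = 0) \<and>
     (\<forall>p q. \<forall>X\<in>G p. \<forall>Y\<in>G q. f X Y = ssgn p q * f Y X) \<and>
     (\<forall>X. (\<forall>Y. f X Y = 0) \<longrightarrow> X = 0)"

definition bi_invariant :: "('a \<Rightarrow> 'a \<Rightarrow> 'a) \<Rightarrow> ('a \<Rightarrow> 'a \<Rightarrow> real) \<Rightarrow> bool" where
  "bi_invariant br f \<longleftrightarrow> (\<forall>X Y Z. f (br X Y) Z = f X (br Y Z))"


section \<open>Lie subalgebras of the even part\<close>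

text \<open>The Lie algebras are subspaces \<open>h\<close> of the even part with the bracket \<open>br\<close>, which is
  antisymmetric there, so one-sided and two-sided ideals agree.\<close>

definition lie_ideal :: "('a::real_vector \<Rightarrow> 'a \<Rightarrow> 'a) \<Rightarrow> 'a set \<Rightarrow> 'a set \<Rightarrow> bool" where
  "lie_ideal br h I \<longleftrightarrow> subspace I \<and> I \<subseteq> h \<and> (\<forall>X\<in>h. \<forall>Y\<in>I. br X Y \<in> I)"

definition abelian_lie :: "('a::real_vector \<Rightarrow> 'a \<Rightarrow> 'a) \<Rightarrow> 'a set \<Rightarrow> bool" where
  "abelian_lie br h \<longleftrightarrow> (\<forall>X\<in>h. \<forall>Y\<in>h. br X Y = 0)"

definition simple_lie :: "('a::real_vector \<Rightarrow> 'a \<Rightarrow> 'a) \<Rightarrow> 'a set \<Rightarrow> bool" where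
  "simple_lie br h \<longleftrightarrow> \<not> abelian_lie br h \<and> (\<forall>I. lie_ideal br h I \<longrightarrow> I = {0} \<or> I = h)"

text \<open>Reductive: the adjoint representation is completely reducible.\<close>

definition reductive_lie :: "('a::real_vector \<Rightarrow> 'a \<Rightarrow> 'a) \<Rightarrow> 'a set \<Rightarrow> bool" where
  "reductive_lie br h \<longleftrightarrow>
     (\<forall>I. lie_ideal br h I \<longrightarrow>
        (\<exists>J. lie_ideal br h J \<and> I \<inter> J = {0} \<and> (\<forall>X\<in>h. \<exists>Y\<in>I. \<exists>Z\<in>J. X = Y + Z)))"

definition lie_killing :: "('a::real_vector \<Rightarrow> 'a \<Rightarrow> 'a) \<Rightarrow> 'a set \<Rightarrow> 'a \<Rightarrow> 'a \<Rightarrow> real" where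
  "lie_killing br h X Y = trace_on h (\<lambda>Z. br X (br Y Z))"

text \<open>The index of the adjoint representation of \<open>h\<close> on the odd part. It is a relation because such
  a constant need not exist for a real simple \<open>h\<close> whose complexification is not simple.\<close>

definition is_index ::
    "(bit \<Rightarrow> 'a::real_vector set) \<Rightarrow> ('a \<Rightarrow> 'a \<Rightarrow> 'a) \<Rightarrow> 'a set \<Rightarrow> real \<Rightarrow> bool" where
  "is_index G br h l \<longleftrightarrow>
     (\<forall>X\<in>h. \<forall>Y\<in>h. trace_on (G 1) (\<lambda>Z. br X (br Y Z)) = l * lie_killing br h X Y)"

definition dual_vector :: "('a \<Rightarrow> 'a \<Rightarrow> real) \<Rightarrow> 'a set \<Rightarrow> 'a set \<Rightarrow> 'a \<Rightarrow> 'a" where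
  "dual_vector B h E e = (THE v. v \<in> h \<and> (\<forall>e'\<in>E. B e' v = (if e' = e then 1 else 0)))"

definition casimir ::
    "('a::real_vector \<Rightarrow> 'a \<Rightarrow> 'a) \<Rightarrow> ('a \<Rightarrow> 'a \<Rightarrow> real) \<Rightarrow> 'a set \<Rightarrow> 'a \<Rightarrow> 'a" where
  "casimir br B h Z = (let E = some_basis h in \<Sum>e\<in>E. br e (br (dual_vector B h E e) Z))"


section \<open>The deformed metric and its Ricci tensor\<close>

definition deformed_metric ::
    "(bit \<Rightarrow> 'a::real_vector set) \<Rightarrow> ('a \<Rightarrow> 'a \<Rightarrow> real) \<Rightarrow> nat \<Rightarrow> (nat \<Rightarrow> 'a set) \<Rightarrow> (nat \<Rightarrow> real)
      \<Rightarrow> 'a \<Rightarrow> 'a \<Rightarrow> real" where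
  "deformed_metric G B s k x X Y =
     (\<Sum>i\<le>s. x i * B (component {..s} k i (part G 0 X)) (component {..s} k i (part G 0 Y)))
     + B (part G 1 X) (part G 1 Y)"

definition is_levi_civita ::
    "(bit \<Rightarrow> 'a::real_vector set) \<Rightarrow> ('a \<Rightarrow> 'a \<Rightarrow> 'a) \<Rightarrow> ('a \<Rightarrow> 'a \<Rightarrow> real) \<Rightarrow> ('a \<Rightarrow> 'a \<Rightarrow> 'a)
      \<Rightarrow> bool" where
  "is_levi_civita G br f D \<longleftrightarrow>
     bilinear D \<and>
     (\<forall>p q. \<forall>X\<in>G p. \<forall>Y\<in>G q. D X Y \<in> G (p + q)) \<and>
     (\<forall>p q r. \<forall>X\<in>G p. \<forall>Y\<in>G q. \<forall>Z\<in>G r. f (D X Y) Z + ssgn p q * f Y (D X Z) = 0) \<and>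
     (\<forall>p q. \<forall>X\<in>G p. \<forall>Y\<in>G q. D X Y - ssgn p q *\<^sub>R D Y X = br X Y)"

definition levi_civita ::
    "(bit \<Rightarrow> 'a::real_vector set) \<Rightarrow> ('a \<Rightarrow> 'a \<Rightarrow> 'a) \<Rightarrow> ('a \<Rightarrow> 'a \<Rightarrow> real) \<Rightarrow> 'a \<Rightarrow> 'a \<Rightarrow> 'a" where
  "levi_civita G br f = (THE D. is_levi_civita G br f D)"

text \<open>The defining formula of the curvature is for homogeneous \<open>X\<close> and \<open>Y\<close>; it is extended bilinearly
  by summing over the homogeneous parts.\<close>

definition curvature ::
    "(bit \<Rightarrow> 'a::real_vector set) \<Rightarrow> ('a \<Rightarrow> 'a \<Rightarrow> 'a) \<Rightarrow> ('a \<Rightarrow> 'a \<Rightarrow> real) \<Rightarrow> 'a \<Rightarrow> 'a \<Rightarrow> 'a \<Rightarrow> 'a" where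
  "curvature G br f X Y Z =
     (let D = levi_civita G br f in
       \<Sum>p\<in>{0, 1}. \<Sum>q\<in>{0, 1}.
         D (part G p X) (D (part G q Y) Z)
         - ssgn p q *\<^sub>R D (part G q Y) (D (part G p X) Z)
         - D (br (part G p X) (part G q Y)) Z)"

definition ricci ::
    "(bit \<Rightarrow> 'a::real_vector set) \<Rightarrow> ('a \<Rightarrow> 'a \<Rightarrow> 'a) \<Rightarrow> ('a \<Rightarrow> 'a \<Rightarrow> real) \<Rightarrow> 'a \<Rightarrow> 'a \<Rightarrow> real" where
  "ricci G br f X Y = supertrace G (\<lambda>Z. curvature G br f Z X Y)"

end

theory Submission
  imports Defs
begin

text \<open>Let \<open>S\<close> act on \<open>k i\<close> as the scalar \<open>x i / 2\<close>. It is \<open>B\<close>-symmetric and commutes with the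
  adjoint action of the even part, and the Levi-Civita connection is \<open>[X, Y] / 2\<close> on arguments of
  equal parity, \<open>[X - S X, Y]\<close> for \<open>X\<close> even and \<open>Y\<close> odd, and \<open>[X, S Y]\<close> for \<open>X\<close> odd and \<open>Y\<close> even.
  With it the curvature becomes a combination of iterated brackets, whose traces are evaluated by
  expanding them in dual bases of the \<open>k i\<close>. For even arguments the commutator terms have trace
  zero and \<open>tr (ad (S X) ad (S Y))\<close> on the odd part remains. For odd arguments even elements act
  without trace because their adjoint maps are \<open>B\<close>-skew, and the other terms are multiples of
  \<open>B(X, C Y)\<close> with \<open>C\<close> the Casimir operators.\<close>

section \<open>Traces and dual bases\<close>

lemma some_basis:
  assumes "subspace V"
  shows "independent (some_basis V)" "span (some_basis V) = V"
proof -
  obtain E where "E \<subseteq> V" "independent E" "V \<subseteq> span E"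
    by (rule maximal_independent_subset[of V])
  then have "independent E \<and> span E = V"
    using assms by (meson span_minimal subset_antisym)
  then have "independent (some_basis V) \<and> span (some_basis V) = V"
    unfolding some_basis_def by (rule someI)
  then show "independent (some_basis V)" "span (some_basis V) = V" by auto
qed

lemma some_basis_subset:
  assumes "subspace V"
  shows "some_basis V \<subseteq> V"
  using some_basis(2)[OF assms] span_superset by blast

lemma finite_some_basis:
  assumes "subspace V" "finite S" "V \<subseteq> span S"
  shows "finite (some_basis V)"
  using independent_span_bound[OF assms(2) some_basis(1)[OF assms(1)]]
    some_basis_subset[OF assms(1)] assms(3) by blast

text \<open>Representations with respect to a basis of \<open>V\<close> vanish outside \<open>V\<close>; extending the basis to
  the whole space makes the coordinates globally linear.\<close>

definition coordinate :: "'a::real_vector set \<Rightarrow> 'a \<Rightarrow> 'a \<Rightarrow> real" where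
  "coordinate V e Z = representation (extend_basis (some_basis V)) Z e"

lemma linear_coordinate:
  assumes "subspace V"
  shows "linear (coordinate V e)"
proof -
  have ind: "independent (extend_basis (some_basis V))"
    by (rule independent_extend_basis[OF some_basis(1)[OF assms]])
  have sp: "span (extend_basis (some_basis V)) = UNIV"
    by (rule span_extend_basis[OF some_basis(1)[OF assms]])
  show ?thesis
    by (rule linearI)
      (simp_all add: coordinate_def representation_add[OF ind] representation_scale[OF ind] sp)
qed

lemma coordinate_eq:
  assumes "subspace V" "Z \<in> V"
  shows "coordinate V e Z = representation (some_basis V) Z e"
proof -
  have "representation (extend_basis (some_basis V)) Z = representation (some_basis V) Z"
    using assms some_basis[OF assms(1)]
    by (intro representation_extend independent_extend_basis extend_basis_superset) auto
  then show ?thesis by (simp add: coordinate_def)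
qed

lemma sum_coordinate:
  assumes "subspace V" "finite (some_basis V)" "Z \<in> V"
  shows "(\<Sum>e\<in>some_basis V. coordinate V e Z *\<^sub>R e) = Z"
  using sum_representation_eq[OF some_basis(1)[OF assms(1)], of Z "some_basis V"]
    some_basis(2)[OF assms(1)] assms by (simp add: coordinate_eq)

section \<open>Traces of maps on a subspace\<close>

lemma trace_on_cong:
  assumes "subspace V" "\<And>Z. Z \<in> V \<Longrightarrow> f Z = g Z"
  shows "trace_on V f = trace_on V g"
  using assms some_basis_subset[OF assms(1)]
  unfolding trace_on_def Let_def by (intro sum.cong) auto

lemma trace_on_coordinate:
  assumes "subspace V" "\<And>Z. Z \<in> V \<Longrightarrow> f Z \<in> V"
  shows "trace_on V f = (\<Sum>e\<in>some_basis V. coordinate V e (f e))"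
  using assms some_basis_subset[OF assms(1)]
  unfolding trace_on_def Let_def by (intro sum.cong) (auto simp: coordinate_eq)

lemma trace_on_zero:
  assumes "subspace V" "\<And>Z. Z \<in> V \<Longrightarrow> f Z = 0"
  shows "trace_on V f = 0"
  using trace_on_cong[where f = f and g = "\<lambda>Z. 0", OF assms] assms(1)
  by (simp add: trace_on_coordinate subspace_0 linear_0[OF linear_coordinate])

lemma trace_on_add:
  assumes "subspace V" "\<And>Z. Z \<in> V \<Longrightarrow> f Z \<in> V" "\<And>Z. Z \<in> V \<Longrightarrow> g Z \<in> V"
  shows "trace_on V (\<lambda>Z. f Z + g Z) = trace_on V f + trace_on V g"
  using assms
  by (simp add: trace_on_coordinate subspace_add linear_add[OF linear_coordinate] sum.distrib)

lemma trace_on_scale: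
  assumes "subspace V" "\<And>Z. Z \<in> V \<Longrightarrow> f Z \<in> V"
  shows "trace_on V (\<lambda>Z. c *\<^sub>R f Z) = c * trace_on V f"
  using assms
  by (simp add: trace_on_coordinate subspace_scale linear_cmul[OF linear_coordinate] sum_distrib_left)

lemma trace_on_diff:
  assumes "subspace V" "\<And>Z. Z \<in> V \<Longrightarrow> f Z \<in> V" "\<And>Z. Z \<in> V \<Longrightarrow> g Z \<in> V"
  shows "trace_on V (\<lambda>Z. f Z - g Z) = trace_on V f - trace_on V g"
  using assms
  by (simp add: trace_on_coordinate subspace_diff linear_diff[OF linear_coordinate] sum_subtractf)

text \<open>This evaluates a trace without reference to the basis chosen in \<^const>\<open>trace_on\<close>.\<close>

lemma trace_on_finite_rank:
  fixes \<phi> :: "'i \<Rightarrow> 'a::real_vector \<Rightarrow> real"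
  assumes V: "subspace V" "finite (some_basis V)"
    and \<phi>: "\<And>i. i \<in> I \<Longrightarrow> linear (\<phi> i)" and v: "\<And>i. i \<in> I \<Longrightarrow> v i \<in> V"
    and f: "\<And>Z. Z \<in> V \<Longrightarrow> f Z = (\<Sum>i\<in>I. \<phi> i Z *\<^sub>R v i)"
  shows "trace_on V f = (\<Sum>i\<in>I. \<phi> i (v i))"
proof -
  note lin = linear_coordinate[OF V(1)]
  have "f Z \<in> V" if "Z \<in> V" for Z
    using that by (auto simp: f v V intro!: subspace_sum subspace_scale)
  then have "trace_on V f = (\<Sum>e\<in>some_basis V. coordinate V e (f e))"
    using V by (simp add: trace_on_coordinate)
  also have "\<dots> = (\<Sum>e\<in>some_basis V. \<Sum>i\<in>I. \<phi> i e * coordinate V e (v i))"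
    using some_basis_subset[OF V(1)]
    by (intro sum.cong refl) (auto simp: f linear_sum[OF lin] linear_cmul[OF lin] subset_iff)
  also have "\<dots> = (\<Sum>i\<in>I. \<Sum>e\<in>some_basis V. \<phi> i e * coordinate V e (v i))"
    by (rule sum.swap)
  also have "\<dots> = (\<Sum>i\<in>I. \<phi> i (v i))"
  proof (rule sum.cong[OF refl])
    fix i assume i: "i \<in> I"
    have "\<phi> i (v i) = \<phi> i (\<Sum>e\<in>some_basis V. coordinate V e (v i) *\<^sub>R e)"
      using sum_coordinate[OF V v[OF i]] by simp
    then show "(\<Sum>e\<in>some_basis V. \<phi> i e * coordinate V e (v i)) = \<phi> i (v i)"
      by (simp add: linear_sum[OF \<phi>[OF i]] linear_cmul[OF \<phi>[OF i]] mult.commute)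
  qed
  finally show ?thesis .
qed

text \<open>Expanding \<open>f Z\<close> in a basis of \<open>V\<close> presents \<open>f\<close> as
  a finite-rank map on all of \<open>W\<close>, and the resulting diagonal sum runs over the basis
  of \<open>V\<close> alone.\<close>

lemma trace_on_subspace:
  assumes W: "subspace W" "finite (some_basis W)" and V: "subspace V" "finite (some_basis V)"
    and f: "linear f" and "V \<subseteq> W" and fW: "\<And>Z. Z \<in> W \<Longrightarrow> f Z \<in> V"
  shows "trace_on W f = trace_on V f"
proof -
  have "trace_on W f = (\<Sum>e\<in>some_basis V. coordinate V e (f e))"
  proof (rule trace_on_finite_rank[OF W, where \<phi> = "\<lambda>e Z. coordinate V e (f Z)" and v = "\<lambda>e. e"])
    show "linear (\<lambda>Z. coordinate V e (f Z))" for e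
      using linear_compose[OF f linear_coordinate[OF V(1)]] by (simp add: o_def)
    show "f Z = (\<Sum>e\<in>some_basis V. coordinate V e (f Z) *\<^sub>R e)" if "Z \<in> W" for Z
      using sum_coordinate[OF V fW[OF that]] by simp
  qed (use some_basis_subset[OF V(1)] \<open>V \<subseteq> W\<close> in auto)
  also have "\<dots> = trace_on V f"
    using V fW \<open>V \<subseteq> W\<close> by (subst trace_on_coordinate) auto
  finally show ?thesis .
qed

text \<open>Expanding \<open>g Z\<close> in the chosen basis writes \<open>f (g Z)\<close> as a
  combination of the vectors \<open>f e\<close>; the diagonal sum of this presentation is already
  the trace of the reversed product.\<close>

lemma trace_on_commute:
  assumes V: "subspace V" "finite (some_basis V)"
    and f: "linear f" "\<And>Z. Z \<in> V \<Longrightarrow> f Z \<in> V" and g: "linear g" "\<And>Z. Z \<in> V \<Longrightarrow> g Z \<in> V"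
  shows "trace_on V (\<lambda>Z. f (g Z)) = trace_on V (\<lambda>Z. g (f Z))"
proof -
  have "trace_on V (\<lambda>Z. f (g Z)) = (\<Sum>e\<in>some_basis V. coordinate V e (g (f e)))"
  proof (rule trace_on_finite_rank[OF V, where \<phi> = "\<lambda>e Z. coordinate V e (g Z)" and v = f])
    show "linear (\<lambda>Z. coordinate V e (g Z))" for e
      using linear_compose[OF g(1) linear_coordinate[OF V(1)]] by (simp add: o_def)
    fix Z assume "Z \<in> V"
    then have "f (g Z) = f (\<Sum>e\<in>some_basis V. coordinate V e (g Z) *\<^sub>R e)"
      using sum_coordinate[OF V g(2)] by simp
    then show "f (g Z) = (\<Sum>e\<in>some_basis V. coordinate V e (g Z) *\<^sub>R f e)"
      by (simp add: linear_sum[OF f(1)] linear_cmul[OF f(1)])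
  qed (use some_basis_subset[OF V(1)] f(2) in auto)
  also have "\<dots> = trace_on V (\<lambda>Z. g (f Z))"
    using f g V by (subst trace_on_coordinate) auto
  finally show ?thesis .
qed

section \<open>Dual bases for a non-degenerate bilinear form\<close>

lemma bilinear_sum_scaleR_left:
  assumes "bilinear B"
  shows "B (\<Sum>i\<in>I. r i *\<^sub>R g i) w = (\<Sum>i\<in>I. r i *\<^sub>R B (g i) w)"
proof -
  have lin: "linear (\<lambda>v. B v w)" using assms by (simp add: bilinear_def)
  show ?thesis by (simp add: linear_sum[OF lin] linear_cmul[OF lin])
qed

lemma bilinear_sum_scaleR_right:
  assumes "bilinear B"
  shows "B w (\<Sum>i\<in>I. r i *\<^sub>R g i) = (\<Sum>i\<in>I. r i *\<^sub>R B w (g i))"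
proof -
  have lin: "linear (B w)" using assms by (simp add: bilinear_def)
  show ?thesis by (simp add: linear_sum[OF lin] linear_cmul[OF lin])
qed

text \<open>The pairing map \<open>T\<close> is injective on \<open>V\<close> by non-degeneracy,
  hence surjective by a dimension count, and the preimage of \<open>e\<close> is the dual vector.
  Non-degeneracy again gives the uniqueness on which \<open>THE\<close> depends.\<close>

lemma dual_basis:
  fixes B :: "'a::real_vector \<Rightarrow> 'a \<Rightarrow> real"
  assumes V: "subspace V" "finite (some_basis V)" and B: "bilinear B"
    and nondeg: "\<And>v. v \<in> V \<Longrightarrow> (\<And>w. w \<in> V \<Longrightarrow> B w v = 0) \<Longrightarrow> v = 0"
    and e: "e \<in> some_basis V"
  shows "dual_vector B V (some_basis V) e \<in> V"
    and "\<And>e'. e' \<in> some_basis V \<Longrightarrow>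
           B e' (dual_vector B V (some_basis V) e) = (if e' = e then 1 else 0)"
proof -
  let ?E = "some_basis V"
  define T where "T v = (\<Sum>e\<in>?E. B e v *\<^sub>R e)" for v
  have E: "independent ?E" "span ?E = V" "?E \<subseteq> V"
    using some_basis[OF V(1)] some_basis_subset[OF V(1)] by auto
  have T: "linear T"
    by (rule linearI)
      (simp_all add: T_def bilinear_radd[OF B] bilinear_rmul[OF B] scaleR_add_left sum.distrib scaleR_sum_right)
  have coeff: "B e' v = c e'" if "T v = (\<Sum>e\<in>?E. c e *\<^sub>R e)" "e' \<in> ?E" for v e' c
  proof -
    have "(\<Sum>e\<in>?E. (B e v - c e) *\<^sub>R e) = 0"
      using that(1) by (simp add: T_def scaleR_diff_left sum_subtractf)
    from independentD[OF E(1) V(2) subset_refl this that(2)] show ?thesis by simp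
  qed
  have zero: "v = 0" if "v \<in> V" "\<And>e. e \<in> ?E \<Longrightarrow> B e v = 0" for v
  proof (rule nondeg[OF that(1)])
    fix w assume "w \<in> V"
    have "B w v = B (\<Sum>e\<in>?E. coordinate V e w *\<^sub>R e) v"
      using sum_coordinate[OF V \<open>w \<in> V\<close>] by simp
    also have "\<dots> = (\<Sum>e\<in>?E. coordinate V e w * B e v)"
      by (simp add: bilinear_sum_scaleR_left[OF B])
    finally show "B w v = 0" using that(2) by simp
  qed
  have inj: "inj_on T (span ?E)"
  proof (rule inj_onI)
    fix v w assume vw: "v \<in> span ?E" "w \<in> span ?E" "T v = T w"
    then have "T (v - w) = (\<Sum>e\<in>?E. 0 *\<^sub>R e)"
      by (simp add: linear_diff[OF T])
    then have "v - w = 0"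
      using vw E(2) V(1) coeff[of "v - w" "\<lambda>e. 0"] by (intro zero) (auto simp: subspace_diff)
    then show "v = w" by simp
  qed
  have ind: "independent (T ` ?E)"
    by (rule linear_independent_injective_image[OF T E(1) inj])
  have card: "card (T ` ?E) = card ?E"
    using inj span_superset by (meson card_image inj_on_subset)
  have T_in: "T w \<in> V" for w
    using V(1) E(3) by (auto simp: T_def intro!: subspace_sum subspace_scale)
  have "e \<in> span (T ` ?E)"
  proof (rule ccontr)
    \<comment> \<open>Together with \<open>e\<close>, the images of the basis would form
      \<open>card ?E + 1\<close> independent vectors in \<open>V\<close>.\<close>
    assume e': "e \<notin> span (T ` ?E)"
    then have "independent (insert e (T ` ?E))"
      using ind by (rule independent_insertI)
    moreover have "insert e (T ` ?E) \<subseteq> span ?E"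
      using E e T_in by auto
    ultimately have "card (insert e (T ` ?E)) \<le> card ?E"
      using independent_span_bound[OF V(2)] by blast
    moreover have "e \<notin> T ` ?E" using e' span_superset[of "T ` ?E"] by blast
    ultimately show False using card V(2) by simp
  qed
  then obtain v where v: "v \<in> V" "T v = e"
    using linear_span_image[OF T, of ?E] E(2) by auto
  have "T v = (\<Sum>e'\<in>?E. (if e' = e then 1 else 0) *\<^sub>R e')"
    using v(2) e V(2) by (simp add: if_distrib[of "\<lambda>c. c *\<^sub>R _"] cong: if_cong)
  then have dual: "v \<in> V \<and> (\<forall>e'\<in>?E. B e' v = (if e' = e then 1 else 0))"
    using v(1) coeff[of v "\<lambda>e'. if e' = e then 1 else 0"] by simp
  have "w = v" if "w \<in> V \<and> (\<forall>e'\<in>?E. B e' w = (if e' = e then 1 else 0))" for w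
    using that dual V(1) zero[of "w - v"] by (simp add: subspace_diff bilinear_rsub[OF B])
  with dual have "dual_vector B V ?E e \<in> V \<and>
      (\<forall>e'\<in>?E. B e' (dual_vector B V ?E e) = (if e' = e then 1 else 0))"
    unfolding dual_vector_def by (rule theI)
  then show "dual_vector B V (some_basis V) e \<in> V"
    and "\<And>e'. e' \<in> some_basis V \<Longrightarrow>
           B e' (dual_vector B V (some_basis V) e) = (if e' = e then 1 else 0)"
    by auto
qed

text \<open>The sign \<open>c\<close> covers both restrictions of a supersymmetric form: 1 on even
  subspaces, -1 on the odd part. Pairing with \<open>d e\<close> reads off the coordinate at
  \<open>e\<close>; the second expansion holds because both sides have the same pairing with every
  \<open>w\<close> in \<open>V\<close>.\<close>

lemma dual_basis_expansion:
  fixes B :: "'a::real_vector \<Rightarrow> 'a \<Rightarrow> real"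
  assumes V: "subspace V" "finite (some_basis V)" and B: "bilinear B"
    and nondeg: "\<And>v. v \<in> V \<Longrightarrow> (\<And>w. w \<in> V \<Longrightarrow> B w v = 0) \<Longrightarrow> v = 0"
    and sym: "\<And>v w. v \<in> V \<Longrightarrow> w \<in> V \<Longrightarrow> B v w = c * B w v" and c: "c * c = 1"
    and Z: "Z \<in> V"
  defines "E \<equiv> some_basis V" and "d \<equiv> dual_vector B V (some_basis V)"
  shows "Z = (\<Sum>e\<in>E. B Z (d e) *\<^sub>R e)" and "Z = c *\<^sub>R (\<Sum>e\<in>E. B Z e *\<^sub>R d e)"
proof -
  have d: "d e \<in> V" "\<And>e'. e' \<in> E \<Longrightarrow> B e' (d e) = (if e' = e then 1 else 0)" if "e \<in> E" for e
    using dual_basis[OF V B nondeg] that by (auto simp: E_def d_def)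
  have E: "E \<subseteq> V" "finite E"
    using some_basis_subset[OF V(1)] V(2) by (auto simp: E_def)
  have lsum: "B (\<Sum>e\<in>E. r e *\<^sub>R g e) w = (\<Sum>e\<in>E. r e * B (g e) w)" for r g w
    by (simp add: bilinear_sum_scaleR_left[OF B])
  have rsum: "B w (\<Sum>e\<in>E. r e *\<^sub>R g e) = (\<Sum>e\<in>E. r e * B w (g e))" for r g w
    by (simp add: bilinear_sum_scaleR_right[OF B])
  have coord: "B w (d e) = coordinate V e w" if "e \<in> E" "w \<in> V" for e w
  proof -
    have "B w (d e) = (\<Sum>e'\<in>E. coordinate V e' w * B e' (d e))"
      unfolding lsum[symmetric] using sum_coordinate[OF V that(2)] by (simp add: E_def)
    also have "\<dots> = (\<Sum>e'\<in>E. if e' = e then coordinate V e' w else 0)"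
      using d(2)[OF that(1)] by (intro sum.cong) auto
    finally show ?thesis using that E by simp
  qed
  then show "Z = (\<Sum>e\<in>E. B Z (d e) *\<^sub>R e)"
    using sum_coordinate[OF V Z] Z by (simp add: E_def)
  have "Z - c *\<^sub>R (\<Sum>e\<in>E. B Z e *\<^sub>R d e) = 0"
  proof (rule nondeg)
    show "Z - c *\<^sub>R (\<Sum>e\<in>E. B Z e *\<^sub>R d e) \<in> V"
      using V(1) Z d(1) by (auto intro!: subspace_diff subspace_scale subspace_sum)
    fix w assume w: "w \<in> V"
    have "B w (\<Sum>e\<in>E. B Z e *\<^sub>R d e) = (\<Sum>e\<in>E. B Z e * coordinate V e w)"
      using coord w by (simp add: rsum)
    also have "\<dots> = B Z (\<Sum>e\<in>E. coordinate V e w *\<^sub>R e)"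
      by (simp add: rsum mult.commute)
    also have "\<dots> = B Z w"
      using sum_coordinate[OF V w] by (simp add: E_def)
    finally show "B w (Z - c *\<^sub>R (\<Sum>e\<in>E. B Z e *\<^sub>R d e)) = 0"
      using sym[OF w Z] by (simp add: bilinear_rsub[OF B] bilinear_rmul[OF B])
  qed
  then show "Z = c *\<^sub>R (\<Sum>e\<in>E. B Z e *\<^sub>R d e)" by (simp only: right_minus_eq)
qed


section \<open>Direct sums and Lie superalgebras\<close>

lemma
  assumes ds: "direct_sum I V W" and X: "X \<in> W"
  shows component_in: "i \<in> I \<Longrightarrow> component I V i X \<in> V i"
    and sum_component: "(\<Sum>i\<in>I. component I V i X) = X"
proof -
  have "\<exists>!u. u \<in> (\<Pi>\<^sub>E i\<in>I. V i) \<and> X = (\<Sum>i\<in>I. u i)"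
    using ds X by (auto simp: direct_sum_def)
  from theI'[OF this] show "i \<in> I \<Longrightarrow> component I V i X \<in> V i" "(\<Sum>i\<in>I. component I V i X) = X"
    by (auto simp: component_def)
qed

lemma component_unique:
  assumes ds: "direct_sum I V W" and u: "\<And>i. i \<in> I \<Longrightarrow> u i \<in> V i" and X: "X = (\<Sum>i\<in>I. u i)"
    and i: "i \<in> I"
  shows "component I V i X = u i"
proof -
  have "X \<in> W"
    using ds u unfolding X direct_sum_def by (auto intro!: subspace_sum)
  then have ex: "\<exists>!u. u \<in> (\<Pi>\<^sub>E i\<in>I. V i) \<and> X = (\<Sum>i\<in>I. u i)"
    using ds by (auto simp: direct_sum_def)
  \<comment> \<open>Uniqueness in \<open>direct_sum\<close> is among extensional functions, so
    \<open>u\<close> is first cut down to \<open>I\<close>.\<close>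
  moreover have "restrict u I \<in> (\<Pi>\<^sub>E i\<in>I. V i) \<and> X = (\<Sum>i\<in>I. restrict u I i)"
    using u X by auto
  ultimately have "(THE u. u \<in> (\<Pi>\<^sub>E i\<in>I. V i) \<and> X = (\<Sum>i\<in>I. u i)) = restrict u I"
    by (intro the1_equality)
  then show ?thesis using i by (simp add: component_def)
qed

lemma component_add:
  assumes ds: "direct_sum I V W" and "X \<in> W" "Y \<in> W" "i \<in> I"
  shows "component I V i (X + Y) = component I V i X + component I V i Y"
  using assms component_in[OF ds] sum_component[OF ds]
  by (intro component_unique[OF ds]) (auto simp: direct_sum_def sum.distrib intro: subspace_add)

lemma component_scale:
  assumes ds: "direct_sum I V W" and "X \<in> W" "i \<in> I"
  shows "component I V i (c *\<^sub>R X) = c *\<^sub>R component I V i X"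
  using assms component_in[OF ds] sum_component[OF ds]
  by (intro component_unique[OF ds])
    (auto simp: direct_sum_def scaleR_sum_right[symmetric] intro: subspace_scale)

lemma component_of_summand:
  assumes ds: "direct_sum I V W" and "X \<in> V j" "i \<in> I" "j \<in> I"
  shows "component I V i X = (if i = j then X else 0)"
  using assms
  by (intro component_unique[OF ds]) (auto simp: direct_sum_def intro: subspace_0)

lemma ssgn_simps [simp]:
  "ssgn 0 q = 1" "ssgn p 0 = 1" "ssgn 1 1 = - 1"
  by (simp_all add: ssgn_def)

lemma super_metric_sym:
  "super_metric G f \<Longrightarrow> X \<in> G p \<Longrightarrow> Y \<in> G q \<Longrightarrow> f X Y = ssgn p q * f Y X"
  unfolding super_metric_def by blast

context lie_superalgebra
begin

section \<open>Parity rules for brackets and homogeneous parts\<close>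

lemmas br_linear =
  bilinear_ladd[OF bilinear_br] bilinear_radd[OF bilinear_br]
  bilinear_lsub[OF bilinear_br] bilinear_rsub[OF bilinear_br]
  bilinear_lneg[OF bilinear_br] bilinear_rneg[OF bilinear_br]
  bilinear_lmul[OF bilinear_br] bilinear_rmul[OF bilinear_br]
  bilinear_lzero[OF bilinear_br] bilinear_rzero[OF bilinear_br]

lemma linear_br: "linear (br X)" "linear (\<lambda>X. br X Y)"
  using bilinear_br by (auto simp: bilinear_def)

lemma subspace_part: "subspace (G p)"
  using grading by (cases p) (auto simp: direct_sum_def)

lemma finite_some_basis_subspace: "subspace (V :: 'a set) \<Longrightarrow> finite (some_basis V)"
  using finite_dimensional finite_some_basis by (metis subset_UNIV)

lemmas part_closed =
  subspace_add[OF subspace_part] subspace_diff[OF subspace_part] subspace_neg[OF subspace_part]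
  subspace_scale[OF subspace_part] subspace_0[OF subspace_part]

lemma part_in: "part G p X \<in> G p"
  using component_in[OF grading, of X p] by (cases p) auto

lemma part_sum: "part G 0 X + part G 1 X = X"
  using sum_component[OF grading, of X] by simp

lemma part_of_homogeneous: "X \<in> G p \<Longrightarrow> part G q X = (if q = p then X else 0)"
  using component_of_summand[OF grading, of X p q] by (cases p; cases q) auto

lemma linear_part: "linear (part G p)"
  by (rule linearI; cases p)
    (auto intro!: component_add[OF grading] component_scale[OF grading])

lemma br_in:
  "X \<in> G 0 \<Longrightarrow> Y \<in> G p \<Longrightarrow> br X Y \<in> G p"
  "X \<in> G p \<Longrightarrow> Y \<in> G 0 \<Longrightarrow> br X Y \<in> G p"
  "X \<in> G 1 \<Longrightarrow> Y \<in> G 1 \<Longrightarrow> br X Y \<in> G 0"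
  using br_parity[of X 0 Y p] br_parity[of X p Y 0] br_parity[of X 1 Y 1] by (cases p; simp)+

lemma br_skew_even: "X \<in> G 0 \<Longrightarrow> Y \<in> G p \<Longrightarrow> br Y X = - br X Y"
  using br_skew[of Y p X 0] by simp

lemma br_sym_odd: "X \<in> G 1 \<Longrightarrow> Y \<in> G 1 \<Longrightarrow> br Y X = br X Y"
  using br_skew[of Y 1 X 1] by simp

lemma br_jacobi_even:
  "X \<in> G 0 \<Longrightarrow> Y \<in> G p \<Longrightarrow> Z \<in> G q \<Longrightarrow> br (br X Y) Z = br X (br Y Z) - br Y (br X Z)"
  using br_jacobi[of X 0 Y p Z q] by simp

lemma levi_civita_in:
  "is_levi_civita G br f D \<Longrightarrow> X \<in> G p \<Longrightarrow> Y \<in> G q \<Longrightarrow> D X Y \<in> G (p + q)"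
  unfolding is_levi_civita_def by blast

text \<open>Pairing the difference of two candidates with a third vector gives the form
  \<open>T\<close>. Absence of torsion fixes its symmetry in the first two arguments, compatibility
  with \<open>f\<close> that in the last two, and together they force \<open>T\<close> to vanish;
  non-degeneracy of \<open>f\<close> then applies.\<close>

lemma levi_civita_unique:
  assumes f: "super_metric G f" and D: "is_levi_civita G br f D" and D': "is_levi_civita G br f D'"
  shows "D = D'"
proof -
  define T where "T X Y Z = f (D X Y - D' X Y) Z" for X Y Z
  have bf: "bilinear f" and bD: "bilinear D" and bD': "bilinear D'"
    using f D D' by (auto simp: super_metric_def is_levi_civita_def)
  note lin = bilinear_ladd[OF bf] bilinear_radd[OF bf] bilinear_lsub[OF bf] bilinear_rsub[OF bf]
    bilinear_lmul[OF bf] bilinear_rmul[OF bf] bilinear_ladd[OF bD] bilinear_radd[OF bD]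
    bilinear_ladd[OF bD'] bilinear_radd[OF bD']
  have swap12: "T X Y Z = ssgn p q * T Y X Z" if "X \<in> G p" "Y \<in> G q" for p q X Y Z
  proof -
    have "D X Y - D' X Y = ssgn p q *\<^sub>R (D Y X - D' Y X)"
    proof -
      have "D X Y - ssgn p q *\<^sub>R D Y X = br X Y" "D' X Y - ssgn p q *\<^sub>R D' Y X = br X Y"
        using D D' that by (auto simp: is_levi_civita_def)
      then show ?thesis by (simp add: diff_eq_eq scaleR_diff_right)
    qed
    then show ?thesis by (simp add: T_def lin)
  qed
  have swap23: "T X Y Z = - ssgn q r * T X Z Y" if "X \<in> G p" "Y \<in> G q" "Z \<in> G r" for p q r X Y Z
  proof -
    have in_G: "D X Z - D' X Z \<in> G (p + r)"
      using levi_civita_in[OF D that(1,3)] levi_civita_in[OF D' that(1,3)] by (rule part_closed)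
    have "T X Y Z = - ssgn p q * f Y (D X Z - D' X Z)"
    proof -
      have "f (D X Y) Z + ssgn p q * f Y (D X Z) = 0" "f (D' X Y) Z + ssgn p q * f Y (D' X Z) = 0"
        using D D' that by (auto simp: is_levi_civita_def)
      then show ?thesis by (simp add: T_def lin algebra_simps)
    qed
    also have "f Y (D X Z - D' X Z) = ssgn q (p + r) * T X Z Y"
      using super_metric_sym[OF f that(2) in_G] by (simp add: T_def)
    \<comment> \<open>The two signs combine to the exponent \<open>q * (p + p + r)\<close>, which is
      \<open>q * r\<close> in \<open>bit\<close>.\<close>
    finally show ?thesis by (cases p; cases q; cases r) auto
  qed
  text \<open>Six alternating exchanges bring a trilinear form that is supersymmetric in its first two
    arguments and super-antisymmetric in its last two back to its own negative.\<close>
  have T0: "T X Y Z = 0" if X: "X \<in> G p" and Y: "Y \<in> G q" and Z: "Z \<in> G r" for p q r X Y Z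
  proof -
    have "T X Y Z = ssgn p q * T Y X Z" by (rule swap12[OF X Y])
    also have "T Y X Z = - ssgn p r * T Y Z X" by (rule swap23[OF Y X Z])
    also have "T Y Z X = ssgn q r * T Z Y X" by (rule swap12[OF Y Z])
    also have "T Z Y X = - ssgn q p * T Z X Y" by (rule swap23[OF Z Y X])
    also have "T Z X Y = ssgn r p * T X Z Y" by (rule swap12[OF Z X])
    also have "T X Z Y = - ssgn r q * T X Y Z" by (rule swap23[OF X Z Y])
    finally show ?thesis by (cases p; cases q; cases r) simp_all
  qed
  have "D X Y = D' X Y" if X: "X \<in> G p" and Y: "Y \<in> G q" for p q X Y
  proof -
    have "f (D X Y - D' X Y) Z = 0" for Z
      using T0[OF X Y part_in[of 0 Z]] T0[OF X Y part_in[of 1 Z]] part_sum[of Z]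
      unfolding T_def by (metis lin(2) add_0)
    then show ?thesis using f unfolding super_metric_def by (metis right_minus_eq)
  qed
  then have hom: "D (part G p X) (part G q Y) = D' (part G p X) (part G q Y)" for p q X Y
    using part_in by blast
  have "D X Y = D' X Y" for X Y
  proof -
    have "D (part G 0 X + part G 1 X) (part G 0 Y + part G 1 Y) =
        D' (part G 0 X + part G 1 X) (part G 0 Y + part G 1 Y)"
      by (simp only: lin hom)
    then show ?thesis by (simp add: part_sum)
  qed
  then show ?thesis by blast
qed

lemma levi_civita_eq:
  "super_metric G f \<Longrightarrow> is_levi_civita G br f D \<Longrightarrow> levi_civita G br f = D"
  unfolding levi_civita_def using levi_civita_unique by blast

section \<open>Parity of the curvature and of the Ricci tensor\<close>

lemma curvature_homogeneous:
  assumes f: "super_metric G f" and D: "is_levi_civita G br f D" and "Z \<in> G r" "X \<in> G p"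
  shows "curvature G br f Z X Y = D Z (D X Y) - ssgn r p *\<^sub>R D X (D Z Y) - D (br Z X) Y"
proof -
  have b: "bilinear D" using D by (simp add: is_levi_civita_def)
  \<comment> \<open>Of the four parity terms in the definition, three contain a homogeneous part
    equal to zero.\<close>
  show ?thesis
    using assms unfolding curvature_def levi_civita_eq[OF f D] Let_def
    by (cases r; cases p)
      (simp_all add: part_of_homogeneous bilinear_lzero[OF b] bilinear_rzero[OF b] br_linear)
qed

lemma curvature_in:
  assumes f: "super_metric G f" and D: "is_levi_civita G br f D"
    and "Z \<in> G r" "X \<in> G p" "Y \<in> G q"
  shows "curvature G br f Z X Y \<in> G (r + p + q)"
proof -
  note D_in = levi_civita_in[OF D]
  have "r + (p + q) = r + p + q" "p + (r + q) = r + p + q"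
    by (cases p; cases q; cases r; simp)+
  then show ?thesis
    using D_in[OF assms(3) D_in[OF assms(4,5)]] D_in[OF assms(4) D_in[OF assms(3,5)]]
      D_in[OF br_parity[OF assms(3,4)] assms(5)]
    unfolding curvature_homogeneous[OF assms(1-4)]
    by (intro part_closed) auto
qed

text \<open>For \<open>X\<close> and \<open>Y\<close> of equal parity the map \<open>Z\<close> to
  \<open>R(Z, X) Y\<close> preserves parity, so the projections in the supertrace act as the
  identity.\<close>

lemma ricci_homogeneous:
  assumes f: "super_metric G f" and D: "is_levi_civita G br f D"
    and X: "X \<in> G p" and Y: "Y \<in> G p"
  shows "ricci G br f X Y = trace_on (G 0) (\<lambda>Z. curvature G br f Z X Y)
    - trace_on (G 1) (\<lambda>Z. curvature G br f Z X Y)"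
proof -
  have "part G r (curvature G br f Z X Y) = curvature G br f Z X Y" if "Z \<in> G r" for r Z
    using curvature_in[OF f D that X Y] by (cases p; cases r) (auto simp: part_of_homogeneous)
  then show ?thesis
    unfolding ricci_def supertrace_def
    by (intro arg_cong2[where f = "(-)"] trace_on_cong subspace_part)
qed

text \<open>Here the map under the supertrace exchanges even and odd parts, so both diagonal blocks
  vanish.\<close>

lemma ricci_mixed:
  assumes f: "super_metric G f" and D: "is_levi_civita G br f D"
    and X: "X \<in> G p" and Y: "Y \<in> G q" and "p \<noteq> q"
  shows "ricci G br f X Y = 0"
proof -
  have "part G r (curvature G br f Z X Y) = 0" if "Z \<in> G r" for r Z
    using curvature_in[OF f D that X Y] \<open>p \<noteq> q\<close>
    by (cases p; cases r; cases q) (auto simp: part_of_homogeneous)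
  then show ?thesis
    unfolding ricci_def supertrace_def by (simp add: trace_on_zero subspace_part)
qed

end


section \<open>The projections of a bi-invariant decomposition\<close>

text \<open>The span of the brackets is an ideal, and it is nonzero because a simple algebra is not
  Abelian.\<close>

lemma simple_lie_spanned_by_brackets:
  assumes br: "bilinear br" and closed: "\<And>X Y. X \<in> h \<Longrightarrow> Y \<in> h \<Longrightarrow> br X Y \<in> h"
    and h: "subspace h" and simple: "simple_lie br h"
  shows "h = span {br X Y | X Y. X \<in> h \<and> Y \<in> h}" (is "_ = span ?S")
proof -
  have sub: "span ?S \<subseteq> h"
    using closed h by (intro span_minimal) auto
  have "lie_ideal br h (span ?S)"
    unfolding lie_ideal_def using sub by (auto intro!: span_base)
  moreover have "span ?S \<noteq> {0}"
    using simple span_base[of _ ?S] unfolding simple_lie_def abelian_lie_def by blast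
  ultimately show ?thesis
    using simple unfolding simple_lie_def by blast
qed

text \<open>Orthogonality of the ideals and non-degeneracy of \<open>B\<close> on each of them are
  consequences of these assumptions, proved below as \<open>k_orthogonal\<close> and
  \<open>B_nondeg_k\<close>.\<close>

locale bi_invariant_decomposition = lie_superalgebra G br
  for G :: "bit \<Rightarrow> 'a::real_vector set" and br +
  fixes B :: "'a \<Rightarrow> 'a \<Rightarrow> real" and s :: nat and k :: "nat \<Rightarrow> 'a set"
  assumes decomposition: "direct_sum {..s} k (G 0)"
    and ideals: "\<And>i. i \<le> s \<Longrightarrow> lie_ideal br (G 0) (k i)"
    and abelian: "abelian_lie br (k 0)"
    and simple: "\<And>i. 1 \<le> i \<Longrightarrow> i \<le> s \<Longrightarrow> simple_lie br (k i)"
    and metric: "super_metric G B"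
    and bi_inv: "bi_invariant br B"
begin

lemma bilinear_B: "bilinear B"
  using metric by (simp add: super_metric_def)

lemmas B_linear =
  bilinear_ladd[OF bilinear_B] bilinear_radd[OF bilinear_B]
  bilinear_lsub[OF bilinear_B] bilinear_rsub[OF bilinear_B]
  bilinear_lneg[OF bilinear_B] bilinear_rneg[OF bilinear_B]
  bilinear_lmul[OF bilinear_B] bilinear_rmul[OF bilinear_B]
  bilinear_lzero[OF bilinear_B] bilinear_rzero[OF bilinear_B]

lemma linear_B: "linear (B X)" "linear (\<lambda>X. B X Y)"
  using bilinear_B by (auto simp: bilinear_def)

lemma B_inv: "B (br X Y) Z = B X (br Y Z)"
  using bi_inv by (simp add: bi_invariant_def)

lemma B_sym: "X \<in> G p \<Longrightarrow> Y \<in> G q \<Longrightarrow> B X Y = ssgn p q * B Y X"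
  by (rule super_metric_sym[OF metric])

lemma B_mixed: "X \<in> G p \<Longrightarrow> Y \<in> G q \<Longrightarrow> p \<noteq> q \<Longrightarrow> B X Y = 0"
proof (cases "p = 0")
  case True
  assume "X \<in> G p" "Y \<in> G q" "p \<noteq> q"
  with True show ?thesis using metric by (auto simp: super_metric_def)
next
  case False
  assume "X \<in> G p" "Y \<in> G q" "p \<noteq> q"
  with False have "X \<in> G 1" "Y \<in> G 0" by auto
  then have "B X Y = B Y X" "B Y X = 0"
    using B_sym[of X 1 Y 0] metric by (auto simp: super_metric_def)
  then show ?thesis by simp
qed

text \<open>Invariance moves the right entry of a bracket across. Exchanging the entries first costs
  the minus sign, with no parity sign since \<open>X\<close> is even.\<close>

lemma B_ad_skew: "X \<in> G 0 \<Longrightarrow> Y \<in> G p \<Longrightarrow> B (br X Y) Z = - B Y (br X Z)"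
  using br_skew_even[of Y X p] B_inv[of Y X Z] br_skew_even[of X Y p] by (simp add: B_linear)

lemma B_nondeg: "(\<And>Y. B X Y = 0) \<Longrightarrow> X = 0"
  using metric unfolding super_metric_def by blast

text \<open>Vectors of different parity are orthogonal, so testing against the parity of
  \<open>X\<close> suffices.\<close>

lemma B_nondeg_part:
  assumes X: "X \<in> G p" and "\<And>Y. Y \<in> G p \<Longrightarrow> B X Y = 0"
  shows "X = 0"
proof (rule B_nondeg)
  fix Y
  have "B X (part G q Y) = 0" for q
    using assms part_in B_mixed[OF X] by (cases "q = p") blast+
  then show "B X Y = 0"
    using part_sum[of Y] B_linear(2) by (metis add_0)
qed

section \<open>The ideals of the even part and their orthogonality\<close>

lemma k_subset: "i \<le> s \<Longrightarrow> X \<in> k i \<Longrightarrow> X \<in> G 0"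
  using ideals by (auto simp: lie_ideal_def)

lemma subspace_k: "i \<le> s \<Longrightarrow> subspace (k i)"
  using ideals by (auto simp: lie_ideal_def)

lemma br_k:
  assumes "i \<le> s" "X \<in> k i" "Y \<in> G 0"
  shows "br Y X \<in> k i" "br X Y \<in> k i"
proof -
  show "br Y X \<in> k i"
    using assms ideals by (auto simp: lie_ideal_def)
  then show "br X Y \<in> k i"
    using br_skew_even[OF assms(3) k_subset[OF assms(1,2)]] br_skew_even[OF k_subset[OF assms(1,2)] assms(3)]
      subspace_neg[OF subspace_k[OF assms(1)]] by metis
qed

text \<open>Passing through the even part gives a linear map on the whole algebra, whereas
  \<open>component\<close> by itself is meaningful only on \<open>G 0\<close>.\<close>

definition proj :: "nat \<Rightarrow> 'a \<Rightarrow> 'a" where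
  "proj i X = component {..s} k i (part G 0 X)"

lemma proj_in: "i \<le> s \<Longrightarrow> proj i X \<in> k i"
  unfolding proj_def by (rule component_in[OF decomposition part_in]) simp

lemma linear_proj: "i \<le> s \<Longrightarrow> linear (proj i)"
  by (rule linearI)
    (auto simp: proj_def linear_add[OF linear_part] linear_cmul[OF linear_part]
      intro!: component_add[OF decomposition] component_scale[OF decomposition] part_in)

lemma proj_sum: "(\<Sum>i\<le>s. proj i X) = part G 0 X"
  unfolding proj_def by (rule sum_component[OF decomposition part_in])

lemma proj_k: "i \<le> s \<Longrightarrow> j \<le> s \<Longrightarrow> X \<in> k j \<Longrightarrow> proj i X = (if i = j then X else 0)"
  unfolding proj_def using component_of_summand[OF decomposition, of X j i] k_subset[of j X]
  by (auto simp: part_of_homogeneous)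

text \<open>The bracket lies in both ideals, and these meet only in 0 because the sum is
  direct.\<close>

lemma br_k_disjoint:
  assumes "i \<le> s" "j \<le> s" "i \<noteq> j" "X \<in> k i" "Y \<in> k j"
  shows "br X Y = 0"
proof -
  have "br X Y \<in> k i" "br X Y \<in> k j"
    using assms br_k k_subset by blast+
  then show ?thesis
    using proj_k[of i i "br X Y"] proj_k[of i j "br X Y"] assms by auto
qed

lemma k_span:
  assumes "1 \<le> i" "i \<le> s"
  shows "k i = span {br X Y | X Y. X \<in> k i \<and> Y \<in> k i}"
  using assms br_k k_subset
  by (intro simple_lie_spanned_by_brackets bilinear_br subspace_k simple) blast+

text \<open>A simple \<open>k j\<close> is spanned by brackets, and B(X, [U, V]) = B([X, U], V) = 0
  since different ideals commute.\<close>

lemma k_orthogonal_simple: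
  assumes "i \<le> s" "j \<le> s" "i \<noteq> j" "1 \<le> j" "X \<in> k i" "Y \<in> k j"
  shows "B X Y = 0"
proof -
  have "Y \<in> span {br U V | U V. U \<in> k j \<and> V \<in> k j}"
    using k_span assms by blast
  then show ?thesis
  proof (induction rule: span_induct)
    case base
    show ?case by (rule linear_subspace_kernel[OF linear_B(1), unfolded])
  next
    case (step Y)
    then show ?case
      using assms by (auto simp: B_inv[symmetric] br_k_disjoint B_linear)
  qed
qed

text \<open>At most one of two distinct indices is 0, so symmetry of \<open>B\<close> on the even
  part reduces this to a simple second ideal.\<close>

lemma k_orthogonal:
  assumes "i \<le> s" "j \<le> s" "i \<noteq> j" "X \<in> k i" "Y \<in> k j"
  shows "B X Y = 0"
proof (cases "1 \<le> j")
  case True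
  then show ?thesis using k_orthogonal_simple assms by blast
next
  case False
  then have "B Y X = 0" using k_orthogonal_simple[of j i Y X] assms by auto
  then show ?thesis using B_sym[of X 0 Y 0] k_subset assms by simp
qed

lemma B_proj_k:
  assumes "i \<le> s" "Y \<in> k i"
  shows "B (proj i X) Y = B X Y"
proof -
  have "B X Y = B (part G 0 X) Y + B (part G 1 X) Y"
    using part_sum[of X] B_linear(1) by metis
  also have "B (part G 1 X) Y = 0"
    using assms k_subset part_in by (intro B_mixed[of _ 1 _ 0]) auto
  also have "B (part G 0 X) Y = (\<Sum>j\<le>s. B (proj j X) Y)"
    by (simp add: proj_sum[symmetric] linear_sum[OF linear_B(2)])
  also have "\<dots> = (\<Sum>j\<le>s. if j = i then B (proj i X) Y else 0)"
    using assms k_orthogonal proj_in by (intro sum.cong) auto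
  finally show ?thesis using assms by simp
qed

lemma B_k_proj:
  assumes "i \<le> s" "Y \<in> k i"
  shows "B Y (proj i X) = B Y X"
proof -
  have "B Y X = B Y (part G 0 X) + B Y (part G 1 X)"
    using part_sum[of X] B_linear(2) by metis
  also have "B Y (part G 1 X) = 0"
    using assms k_subset part_in by (intro B_mixed[of _ 0 _ 1]) auto
  also have "B Y (part G 0 X) = (\<Sum>j\<le>s. B Y (proj j X))"
    by (simp add: proj_sum[symmetric] linear_sum[OF linear_B(1)])
  also have "\<dots> = (\<Sum>j\<le>s. if j = i then B Y (proj i X) else 0)"
    using assms k_orthogonal proj_in by (intro sum.cong) auto
  finally show ?thesis using assms by simp
qed

lemma B_proj: "i \<le> s \<Longrightarrow> B (proj i X) Y = B X (proj i Y)"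
  using B_proj_k[of i "proj i Y" X] B_k_proj[of i "proj i X" Y] proj_in by simp

text \<open>By orthogonality, pairing an element of \<open>k i\<close> with any vector is the same
  as pairing it with the projection of that vector to \<open>k i\<close>.\<close>

lemma B_nondeg_k:
  assumes i: "i \<le> s" and v: "v \<in> k i" and w: "\<And>w. w \<in> k i \<Longrightarrow> B w v = 0"
  shows "v = 0"
proof (rule B_nondeg)
  fix Y
  have "B v Y = B v (proj i Y)" using B_k_proj[OF i v] by simp
  also have "\<dots> = B (proj i Y) v"
    using B_sym[of v 0 "proj i Y" 0] k_subset[OF i] v proj_in[OF i] by simp
  finally show "B v Y = 0" using w proj_in[OF i] by simp
qed

section \<open>Dual bases of the ideals and scaling along the decomposition\<close>

definition dual :: "nat \<Rightarrow> 'a \<Rightarrow> 'a" where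
  "dual i = dual_vector B (k i) (some_basis (k i))"

lemma basis_k_in: "i \<le> s \<Longrightarrow> e \<in> some_basis (k i) \<Longrightarrow> e \<in> k i"
  using some_basis_subset[OF subspace_k] by blast

lemma dual_in: "i \<le> s \<Longrightarrow> e \<in> some_basis (k i) \<Longrightarrow> dual i e \<in> k i"
  unfolding dual_def
  by (rule dual_basis(1)[OF subspace_k finite_some_basis_subspace[OF subspace_k] bilinear_B B_nondeg_k])

text \<open>The coefficients pair with \<open>Z\<close> itself instead of with its projection. They
  are thus linear functionals on the whole algebra, as the finite-rank trace formula
  requires.\<close>

lemma proj_expansion:
  assumes i: "i \<le> s"
  shows "proj i Z = (\<Sum>e\<in>some_basis (k i). B Z (dual i e) *\<^sub>R e)"
    and "proj i Z = (\<Sum>e\<in>some_basis (k i). B Z e *\<^sub>R dual i e)"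
proof -
  have sym: "B v w = 1 * B w v" if "v \<in> k i" "w \<in> k i" for v w
    using B_sym[of v 0 w 0] k_subset[OF i] that by simp
  note expansion = dual_basis_expansion[OF subspace_k[OF i] finite_some_basis_subspace[OF subspace_k[OF i]]
      bilinear_B B_nondeg_k[OF i] sym _ proj_in[OF i, of Z], folded dual_def]
  show "proj i Z = (\<Sum>e\<in>some_basis (k i). B Z (dual i e) *\<^sub>R e)"
    using expansion(1) i by (simp add: B_proj_k dual_in)
  show "proj i Z = (\<Sum>e\<in>some_basis (k i). B Z e *\<^sub>R dual i e)"
    using expansion(2) i by (simp add: B_proj_k basis_k_in)
qed

lemma casimir_eq:
  "casimir br B (k i) Y = (\<Sum>e\<in>some_basis (k i). br e (br (dual i e) Y))"
  by (simp add: casimir_def dual_def Let_def)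

text \<open>Since every \<open>k i\<close> is an ideal, bracketing the decomposition of
  \<open>Y\<close> with \<open>X\<close> gives the decomposition of the bracket.\<close>

lemma proj_br:
  assumes i: "i \<le> s" and X: "X \<in> G 0" and Y: "Y \<in> G 0"
  shows "proj i (br X Y) = br X (proj i Y)"
proof -
  have "br X Y = (\<Sum>i\<le>s. br X (proj i Y))"
    using proj_sum[of Y] Y by (simp add: linear_sum[OF linear_br(1), symmetric] part_of_homogeneous)
  then show ?thesis
    using i X Y br_k proj_in br_in(1)[OF X Y]
    unfolding proj_def[of i "br X Y"]
    by (simp add: part_of_homogeneous) (intro component_unique[OF decomposition], auto)
qed

text \<open>The weights are kept general because several are used: \<open>x i / 2\<close> for
  \<open>S\<close>, \<open>2 / x i\<close> for its inverse on the even part, and the constant 1 for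
  the even projection.\<close>

definition rescale :: "(nat \<Rightarrow> real) \<Rightarrow> 'a \<Rightarrow> 'a" where
  "rescale y X = (\<Sum>i\<le>s. y i *\<^sub>R proj i X)"

lemma linear_rescale: "linear (rescale y)"
  unfolding rescale_def
  by (intro linear_compose_sum ballI linear_compose_scale_right linear_proj) auto

lemmas rescale_linear =
  linear_add[OF linear_rescale] linear_diff[OF linear_rescale] linear_neg[OF linear_rescale]
  linear_cmul[OF linear_rescale] linear_0[OF linear_rescale]

lemma rescale_in: "rescale y X \<in> G 0"
  unfolding rescale_def using k_subset proj_in by (auto intro!: subspace_sum part_closed subspace_part)

lemma rescale_k: "i \<le> s \<Longrightarrow> X \<in> k i \<Longrightarrow> rescale y X = y i *\<^sub>R X"
  by (simp add: rescale_def proj_k if_distrib cong: if_cong)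

lemma B_rescale: "B (rescale y X) Y = B X (rescale y Y)"
  by (simp add: rescale_def bilinear_sum_scaleR_left[OF bilinear_B]
      bilinear_sum_scaleR_right[OF bilinear_B] B_proj)

lemma rescale_br:
  assumes "X \<in> G 0" "Y \<in> G 0"
  shows "rescale y (br X Y) = br X (rescale y Y)" "rescale y (br X Y) = br (rescale y X) Y"
proof -
  have eq: "rescale y (br X Y) = br X (rescale y Y)" if "X \<in> G 0" "Y \<in> G 0" for X Y
    using that by (simp add: rescale_def proj_br bilinear_sum_scaleR_right[OF bilinear_br])
  show "rescale y (br X Y) = br X (rescale y Y)" using eq assms .
  show "rescale y (br X Y) = br (rescale y X) Y"
    using eq[OF assms(2,1)] br_skew_even[OF assms] br_skew_even[OF assms(2) rescale_in[of y X]]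
    by (simp add: rescale_linear minus_equation_iff[of "rescale y (br X Y)"])
qed

text \<open>By \<open>B\<close>-symmetry of \<open>rescale y\<close>, the pairing with an even
  \<open>Y\<close> equals the pairing of the odd \<open>X\<close> with an even vector.\<close>

lemma rescale_odd: "X \<in> G 1 \<Longrightarrow> rescale y X = 0"
proof (rule B_nondeg_part[OF rescale_in])
  fix Y assume "X \<in> G 1" "Y \<in> G 0"
  then show "B (rescale y X) Y = 0"
    by (simp add: B_rescale B_mixed[OF _ rescale_in])
qed

lemma rescale_one: "rescale (\<lambda>_. 1) X = part G 0 X"
  by (simp add: rescale_def proj_sum)

lemma rescale_rescale: "rescale y (rescale z X) = rescale (\<lambda>i. y i * z i) X"
  unfolding rescale_def[of _ X]
  by (simp add: linear_sum[OF linear_rescale] rescale_linear rescale_k proj_in mult.commute)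

text \<open>The trace is computed twice, expanding first in a basis and then in its dual basis.
  Skewness of the adjoint map turns one sum into the negative of the other; \<open>ssgn p p\<close>
  absorbs the antisymmetry of \<open>B\<close> on the odd part.\<close>

lemma trace_ad_even:
  assumes W: "W \<in> G 0"
  shows "trace_on (G p) (br W) = 0"
proof -
  let ?E = "some_basis (G p)" and ?d = "dual_vector B (G p) (some_basis (G p))"
  have V: "subspace (G p)" "finite ?E"
    using subspace_part finite_some_basis_subspace by auto
  have nondeg: "v = 0" if "v \<in> G p" "\<And>w. w \<in> G p \<Longrightarrow> B w v = 0" for v
    using that B_sym[OF that(1)] by (intro B_nondeg_part[OF that(1)]) simp
  have sq: "ssgn p p * ssgn p p = 1" by (cases p) simp_all
  have in_G: "br W Z \<in> G p" if "Z \<in> G p" for Z using br_in(1)[OF W that] .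
  note expansion = dual_basis_expansion[OF V bilinear_B nondeg B_sym sq in_G]
  have E: "e \<in> G p" "?d e \<in> G p" if "e \<in> ?E" for e
    using that some_basis_subset[OF V(1)] dual_basis(1)[OF V bilinear_B nondeg] by auto
  have lin: "linear (\<lambda>Z. B (br W Z) U)" for U
    using linear_compose[OF linear_br(1) linear_B(2)] by (simp add: o_def)
  have 1: "trace_on (G p) (br W) = (\<Sum>e\<in>?E. B (br W e) (?d e))"
    using E lin by (intro trace_on_finite_rank[OF V, where \<phi> = "\<lambda>e Z. B (br W Z) (?d e)"] expansion(1)) auto
  have "br W Z = (\<Sum>e\<in>?E. (ssgn p p *\<^sub>R B (br W Z) e) *\<^sub>R ?d e)" if "Z \<in> G p" for Z
    by (rule trans[OF expansion(2)]) (simp_all add: that scaleR_sum_right)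
  then have "trace_on (G p) (br W) = (\<Sum>e\<in>?E. ssgn p p *\<^sub>R B (br W (?d e)) e)"
    using E lin by (intro trace_on_finite_rank[OF V, where \<phi> = "\<lambda>e Z. ssgn p p *\<^sub>R B (br W Z) e"]
        linear_compose_scale_right) auto
  also have "\<dots> = (\<Sum>e\<in>?E. - B (br W e) (?d e))"
  proof (rule sum.cong[OF refl])
    fix e assume e: "e \<in> ?E"
    show "ssgn p p *\<^sub>R B (br W (?d e)) e = - B (br W e) (?d e)"
      using B_ad_skew[OF W E(2)[OF e], of e] B_sym[OF E(2)[OF e] in_G[OF E(1)[OF e]]] sq
      by (simp add: mult.assoc[symmetric])
  qed
  finally show ?thesis using 1 by (simp add: sum_negf)
qed

end


section \<open>The Levi-Civita connection of the deformed metric\<close>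

locale deformed_bi_invariant_metric = bi_invariant_decomposition G br B s k
  for G :: "bit \<Rightarrow> 'a::real_vector set" and br B s k +
  fixes x :: "nat \<Rightarrow> real"
  assumes nonzero: "\<And>i. i \<le> s \<Longrightarrow> x i \<noteq> 0"
begin

abbreviation f :: "'a \<Rightarrow> 'a \<Rightarrow> real" where
  "f \<equiv> deformed_metric G B s k x"

text \<open>The half is the factor that the connection carries; the metric on the even part is then
  \<open>2 * B (S X) Y\<close>.\<close>

abbreviation S :: "'a \<Rightarrow> 'a" where
  "S \<equiv> rescale (\<lambda>i. x i / 2)"

lemma deformed_metric_eq: "f X Y = 2 * B (S X) Y + B (part G 1 X) (part G 1 Y)"
proof -
  have "x i * B (proj i X) (proj i Y) = 2 * ((x i / 2) * B (proj i X) Y)" if "i \<le> s" for i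
    using that proj_in by (simp add: B_k_proj)
  then have "(\<Sum>i\<le>s. x i * B (proj i X) (proj i Y)) = (\<Sum>i\<le>s. 2 * ((x i / 2) * B (proj i X) Y))"
    by (intro sum.cong) auto
  also have "\<dots> = 2 * B (S X) Y"
    by (simp add: rescale_def bilinear_sum_scaleR_left[OF bilinear_B] sum_distrib_left)
  finally show ?thesis by (simp add: deformed_metric_def proj_def)
qed

lemma deformed_metric_homogeneous:
  "X \<in> G 0 \<Longrightarrow> f X Y = 2 * B (S X) Y"
  "Y \<in> G 0 \<Longrightarrow> f X Y = 2 * B (S X) Y"
  "X \<in> G 1 \<Longrightarrow> Y \<in> G 1 \<Longrightarrow> f X Y = B X Y"
  by (simp_all add: deformed_metric_eq part_of_homogeneous rescale_odd B_linear)

lemma super_metric_deformed: "super_metric G f"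
proof -
  have "bilinear f"
    unfolding bilinear_def
    by (intro conjI allI linearI)
      (simp_all add: deformed_metric_eq rescale_linear B_linear linear_add[OF linear_part]
        linear_cmul[OF linear_part] algebra_simps)
  moreover have mixed: "f X Y = 0" "f Y X = 0" if "X \<in> G 0" "Y \<in> G 1" for X Y
    using that B_mixed[OF rescale_in, of Y 1 _ X]
    by (simp_all add: deformed_metric_homogeneous rescale_odd B_linear)
  moreover have "f X Y = ssgn p q * f Y X" if X: "X \<in> G p" and Y: "Y \<in> G q" for p q X Y
  proof -
    have "f X Y = f Y X" if "X \<in> G 0" "Y \<in> G 0"
      using that B_sym[OF _ rescale_in, of X 0] B_rescale
      by (simp add: deformed_metric_homogeneous)
    moreover have "f X Y = - f Y X" if "X \<in> G 1" "Y \<in> G 1"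
      using that B_sym[of X 1 Y 1] by (simp add: deformed_metric_homogeneous)
    ultimately show ?thesis
      using X Y mixed by (cases p; cases q) auto
  qed
  moreover have "X = 0" if X: "\<And>Y. f X Y = 0" for X
  proof -
    have "S X = 0"
    proof (rule B_nondeg_part[OF rescale_in])
      fix Y assume "Y \<in> G 0"
      then show "B (S X) Y = 0"
        using X[of Y] by (simp add: deformed_metric_homogeneous)
    qed
    \<comment> \<open>The weights \<open>2 / x i\<close> undo \<open>S\<close> on the even part,
      which is where \<open>nonzero\<close> enters.\<close>
    then have "rescale (\<lambda>i. 2 / x i) (S X) = 0" by (simp add: rescale_linear)
    moreover have "rescale (\<lambda>i. 2 / x i) (S X) = rescale (\<lambda>_. 1) X"
      unfolding rescale_rescale unfolding rescale_def using nonzero by (intro sum.cong) auto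
    ultimately have "part G 0 X = 0" by (simp add: rescale_one)
    moreover have "part G 1 X = 0"
    proof (rule B_nondeg_part[OF part_in])
      fix Y assume "Y \<in> G 1"
      then show "B (part G 1 X) Y = 0"
        using X[of Y] \<open>S X = 0\<close> by (simp add: deformed_metric_eq part_of_homogeneous B_linear)
    qed
    ultimately show ?thesis using part_sum[of X] by simp
  qed
  ultimately show ?thesis unfolding super_metric_def by blast
qed

text \<open>Starting from half the bracket on equal parities, metric compatibility for odd
  \<open>X\<close>, \<open>Y\<close> against an even third vector forces [X, S Y] for odd
  \<open>X\<close> and even \<open>Y\<close>. Vanishing torsion then forces [X - S X, Y] for even
  \<open>X\<close> and odd \<open>Y\<close>.\<close>

definition conn :: "'a \<Rightarrow> 'a \<Rightarrow> 'a" where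
  "conn X Y = (1 / 2) *\<^sub>R (br (part G 0 X) (part G 0 Y) + br (part G 1 X) (part G 1 Y))
     + br (part G 0 X - S X) (part G 1 Y) + br (part G 1 X) (S Y)"

lemma conn_homogeneous:
  "X \<in> G 0 \<Longrightarrow> Y \<in> G 0 \<Longrightarrow> conn X Y = (1 / 2) *\<^sub>R br X Y"
  "X \<in> G 0 \<Longrightarrow> Y \<in> G 1 \<Longrightarrow> conn X Y = br (X - S X) Y"
  "X \<in> G 1 \<Longrightarrow> Y \<in> G 0 \<Longrightarrow> conn X Y = br X (S Y)"
  "X \<in> G 1 \<Longrightarrow> Y \<in> G 1 \<Longrightarrow> conn X Y = (1 / 2) *\<^sub>R br X Y"
  by (simp_all add: conn_def part_of_homogeneous br_linear rescale_odd)

lemma bilinear_conn: "bilinear conn"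
  unfolding bilinear_def
  by (intro conjI allI linearI)
    (simp_all add: conn_def br_linear rescale_linear linear_add[OF linear_part]
      linear_cmul[OF linear_part] algebra_simps)

lemma conn_in:
  assumes "X \<in> G p" "Y \<in> G q"
  shows "conn X Y \<in> G (p + q)"
  using assms by (cases p; cases q)
    (simp_all add: conn_homogeneous br_in part_closed rescale_in)

text \<open>Each surviving parity pattern reduces to invariance of \<open>B\<close>, after
  \<open>S\<close> has been moved across the form or through a bracket of even elements.\<close>

lemma conn_metric:
  assumes X: "X \<in> G p" and Y: "Y \<in> G q" and Z: "Z \<in> G r"
  shows "f (conn X Y) Z + ssgn p q * f Y (conn X Z) = 0"
proof -
  have zero: "f V W = 0" if "V \<in> G a" "W \<in> G b" "a \<noteq> b" for V W a b
    using that super_metric_deformed super_metric_sym[OF super_metric_deformed that(1,2)]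
    unfolding super_metric_def by (metis (full_types) bit_not_one_iff mult_zero_right)
  show ?thesis
  proof (cases "r = p + q")
    case False
    then have "p + r \<noteq> q" by (cases p; cases q; cases r) auto
    then have "f (conn X Y) Z = 0" "f Y (conn X Z) = 0"
      using zero[OF conn_in[OF X Y] Z] zero[OF Y conn_in[OF X Z]] False by auto
    then show ?thesis by simp
  next
    case True
    \<comment> \<open>Both terms vanish by parity unless none or exactly two of the arguments are
      odd.\<close>
    consider "X \<in> G 0" "Y \<in> G 0" "Z \<in> G 0" "ssgn p q = 1"
      | "X \<in> G 0" "Y \<in> G 1" "Z \<in> G 1" "ssgn p q = 1"
      | "X \<in> G 1" "Y \<in> G 0" "Z \<in> G 1" "ssgn p q = 1"
      | "X \<in> G 1" "Y \<in> G 1" "Z \<in> G 0" "ssgn p q = - 1"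
      using X Y Z True by (cases p; cases q; simp)
    then show ?thesis
    proof cases
      case 1
      then show ?thesis
        using B_ad_skew[of X "S Y" 0 Z]
        by (simp add: conn_homogeneous deformed_metric_homogeneous rescale_linear rescale_br
            rescale_in B_linear)
    next
      case 2
      then show ?thesis
        using B_ad_skew[of "X - S X" Y 1 Z]
        by (simp add: conn_homogeneous deformed_metric_homogeneous br_in part_closed rescale_in)
    next
      case 3
      then show ?thesis
        using B_inv[of "S Y" X Z] br_skew_even[OF rescale_in, of X 1 "\<lambda>i. x i / 2" Y]
        by (simp add: conn_homogeneous deformed_metric_homogeneous br_in part_closed rescale_in B_linear)
    next
      case 4
      then show ?thesis
        using B_inv[of Y X "S Z"] br_sym_odd[of X Y]
        by (simp add: conn_homogeneous deformed_metric_homogeneous br_in part_closed rescale_in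
            part_of_homogeneous B_linear B_rescale rescale_linear)
    qed
  qed
qed

text \<open>For equal parities the two halves add up to the bracket; for mixed parities the two
  terms with \<open>S\<close> cancel.\<close>

lemma conn_torsion_free:
  assumes X: "X \<in> G p" and Y: "Y \<in> G q"
  shows "conn X Y - ssgn p q *\<^sub>R conn Y X = br X Y"
proof -
  consider "X \<in> G 0" "Y \<in> G 0" "ssgn p q = 1" | "X \<in> G 0" "Y \<in> G 1" "ssgn p q = 1"
    | "X \<in> G 1" "Y \<in> G 0" "ssgn p q = 1" | "X \<in> G 1" "Y \<in> G 1" "ssgn p q = - 1"
    using X Y by (cases p; cases q; simp)
  then show ?thesis
  proof cases
    case 1
    then show ?thesis
      using br_skew_even[of X Y 0] by (simp add: conn_homogeneous scaleR_left_distrib[symmetric])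
  next
    case 2
    then show ?thesis
      using br_skew_even[OF rescale_in, of Y 1 "\<lambda>i. x i / 2" X] by (simp add: conn_homogeneous br_linear)
  next
    case 3
    then show ?thesis
      using br_skew_even[OF rescale_in, of X 1 "\<lambda>i. x i / 2" Y] br_skew_even[of Y X 1]
      by (simp add: conn_homogeneous br_linear)
  next
    case 4
    then show ?thesis
      using br_sym_odd[of X Y] by (simp add: conn_homogeneous scaleR_left_distrib[symmetric])
  qed
qed

lemma is_levi_civita_conn: "is_levi_civita G br f conn"
  unfolding is_levi_civita_def
  using bilinear_conn conn_in conn_metric conn_torsion_free by blast

section \<open>The Ricci tensor on even arguments\<close>

abbreviation ric :: "'a \<Rightarrow> 'a \<Rightarrow> real" where
  "ric \<equiv> ricci G br f"

lemmas curvature_conn = curvature_homogeneous[OF super_metric_deformed is_levi_civita_conn]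
lemmas ricci_conn = ricci_homogeneous[OF super_metric_deformed is_levi_civita_conn]

text \<open>On the odd part the curvature is half the commutator of ad X and ad (S Y), minus their
  counterpart ad (S X) ad (S Y). The commutator has trace zero, and the minus sign of the supertrace
  makes the remaining term positive.\<close>

lemma ricci_even:
  assumes X: "X \<in> G 0" and Y: "Y \<in> G 0"
  shows "ric X Y = - (1 / 4) * trace_on (G 0) (\<lambda>Z. br Y (br X Z))
    + trace_on (G 1) (\<lambda>Z. br (S X) (br (S Y) Z))"
proof -
  note SX = rescale_in[of "\<lambda>i. x i / 2" X] and SY = rescale_in[of "\<lambda>i. x i / 2" Y]
  have even: "curvature G br f Z X Y = (- (1 / 4)) *\<^sub>R br Y (br X Z)" if Z: "Z \<in> G 0" for Z
  proof -
    have "br (br Z X) Y = br Z (br X Y) - br X (br Z Y)" "br (br Z X) Y = br Y (br X Z)"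
      using br_jacobi_even[OF Z X Y] br_skew_even[OF X Z] br_skew_even[OF Y br_in(1)[OF X Z]]
      by (simp_all add: br_linear)
    then show ?thesis
      using assms Z by (simp add: curvature_conn[OF Z X] conn_homogeneous br_in br_linear part_closed)
        (simp add: algebra_simps flip: scaleR_left_distrib)
  qed
  have odd: "curvature G br f Z X Y =
      (1 / 2) *\<^sub>R (br X (br (S Y) Z) - br (S Y) (br X Z)) - br (S X) (br (S Y) Z)"
    if Z: "Z \<in> G 1" for Z
  proof -
    have skew: "br Z (S Y) = - br (S Y) Z" "br Z X = - br X Z"
      "br (br X Z) (S Y) = - br (S Y) (br X Z)"
      using br_skew_even[OF SY Z] br_skew_even[OF X Z] br_skew_even[OF SY br_in(1)[OF X Z]] by auto
    \<comment> \<open>As \<open>S\<close> commutes with ad X on the even part, S [X, Y] = [X, S Y],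
      and the Jacobi identity turns its action into a commutator.\<close>
    have "br Z (S (br X Y)) = - br (br X (S Y)) Z"
      using br_skew_even[OF br_in(1)[OF X SY] Z] by (simp add: rescale_br[OF X Y])
    also have "\<dots> = - (br X (br (S Y) Z) - br (S Y) (br X Z))"
      using br_jacobi_even[OF X SY Z] by simp
    finally have "br Z (S (br X Y)) = - (br X (br (S Y) Z) - br (S Y) (br X Z))" .
    then show ?thesis
      using assms Z skew
      by (simp add: curvature_conn[OF Z X] conn_homogeneous br_in br_linear part_closed
          rescale_in rescale_linear)
        (simp add: algebra_simps flip: scaleR_left_distrib)
  qed
  have in_G: "br U (br V Z) \<in> G 1" if "U \<in> G 0" "V \<in> G 0" "Z \<in> G 1" for U V Z
    using that br_in by blast
  have "trace_on (G 1) (\<lambda>Z. curvature G br f Z X Y) =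
      trace_on (G 1) (\<lambda>Z. (1 / 2) *\<^sub>R (br X (br (S Y) Z) - br (S Y) (br X Z)) - br (S X) (br (S Y) Z))"
    by (intro trace_on_cong subspace_part odd)
  also have "\<dots> = (1 / 2) * (trace_on (G 1) (\<lambda>Z. br X (br (S Y) Z)) - trace_on (G 1) (\<lambda>Z. br (S Y) (br X Z)))
      - trace_on (G 1) (\<lambda>Z. br (S X) (br (S Y) Z))"
    using X SX SY by (simp add: trace_on_diff trace_on_scale subspace_part part_closed in_G)
  also have "trace_on (G 1) (\<lambda>Z. br X (br (S Y) Z)) = trace_on (G 1) (\<lambda>Z. br (S Y) (br X Z))"
    using X SY by (intro trace_on_commute subspace_part finite_some_basis_subspace linear_br br_in)
  finally have "trace_on (G 1) (\<lambda>Z. curvature G br f Z X Y) = - trace_on (G 1) (\<lambda>Z. br (S X) (br (S Y) Z))"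
    by simp
  moreover have "trace_on (G 0) (\<lambda>Z. curvature G br f Z X Y) =
      trace_on (G 0) (\<lambda>Z. (- (1 / 4)) *\<^sub>R br Y (br X Z))"
    by (intro trace_on_cong subspace_part even)
  ultimately show ?thesis
    using X Y unfolding ricci_conn[OF X Y]
    by (subst (asm) trace_on_scale) (auto intro: subspace_part br_in)
qed

end


section \<open>Casimir operators and the Ricci tensor\<close>

context bi_invariant_decomposition
begin

text \<open>The bases of all ideals are merged into one index set of pairs, so that a single
  application of \<open>trace_on_finite_rank\<close> handles all summands; the first entry keeps
  track of the weight.\<close>

lemma rescale_expansion:
  "rescale y Z = (\<Sum>(i, e)\<in>(SIGMA i:{..s}. some_basis (k i)). B Z (dual i e) *\<^sub>R y i *\<^sub>R e)"
  "rescale y Z = (\<Sum>(i, e)\<in>(SIGMA i:{..s}. some_basis (k i)). B Z e *\<^sub>R y i *\<^sub>R dual i e)"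
proof -
  have "y i *\<^sub>R proj i Z = (\<Sum>e\<in>some_basis (k i). B Z (dual i e) *\<^sub>R y i *\<^sub>R e)"
    "y i *\<^sub>R proj i Z = (\<Sum>e\<in>some_basis (k i). B Z e *\<^sub>R y i *\<^sub>R dual i e)" if "i \<le> s" for i
    using arg_cong[OF proj_expansion(1)[OF that], of "scaleR (y i)"]
      arg_cong[OF proj_expansion(2)[OF that], of "scaleR (y i)"]
    by (simp_all add: scaleR_sum_right mult.commute)
  note expansion = this
  show "rescale y Z = (\<Sum>(i, e)\<in>(SIGMA i:{..s}. some_basis (k i)). B Z (dual i e) *\<^sub>R y i *\<^sub>R e)"
    unfolding rescale_def
    using expansion(1) by (subst sum.Sigma[symmetric])
      (auto intro!: finite_some_basis_subspace subspace_k sum.cong simp del: scaleR_scaleR)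
  show "rescale y Z = (\<Sum>(i, e)\<in>(SIGMA i:{..s}. some_basis (k i)). B Z e *\<^sub>R y i *\<^sub>R dual i e)"
    unfolding rescale_def
    using expansion(2) by (subst sum.Sigma[symmetric])
      (auto intro!: finite_some_basis_subspace subspace_k sum.cong simp del: scaleR_scaleR)
qed

text \<open>The Ricci tensor on odd arguments will be the difference of this form for the weights
  \<open>x i / 2\<close> and for the weight 1.\<close>

definition casimir_form :: "(nat \<Rightarrow> real) \<Rightarrow> 'a \<Rightarrow> 'a \<Rightarrow> real" where
  "casimir_form y X Y = (\<Sum>i\<le>s. y i * B X (casimir br B (k i) Y))"

lemma casimir_form_expansion:
  "casimir_form y X Y =
    (\<Sum>(i, e)\<in>(SIGMA i:{..s}. some_basis (k i)). y i * B X (br e (br (dual i e) Y)))"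
  by (simp add: casimir_form_def casimir_eq linear_sum[OF linear_B(1)] sum_distrib_left
      finite_some_basis_subspace subspace_k flip: sum.Sigma)

section \<open>Traces that produce Casimir operators\<close>

lemma basis_even:
  assumes "(i, e) \<in> (SIGMA i:{..s}. some_basis (k i))"
  shows "e \<in> G 0" "dual i e \<in> G 0"
  using assms basis_k_in dual_in k_subset by auto

text \<open>With \<open>d\<close> dual to \<open>e\<close>, the diagonal terms B([X, [d, Y]], e)
  equal B(X, [[d, Y], e]) by invariance, and exchanging the outer bracket gives the sign.\<close>

lemma trace_even_casimir:
  assumes X: "X \<in> G 1" and Y: "Y \<in> G 1"
  shows "trace_on (G 0) (\<lambda>Z. br X (br (rescale y Z) Y)) = - casimir_form y X Y"
proof -
  let ?I = "SIGMA i:{..s}. some_basis (k i)"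
  have "trace_on (G 0) (\<lambda>Z. br X (br (rescale y Z) Y)) =
      (\<Sum>p\<in>?I. B (y (fst p) *\<^sub>R br X (br (dual (fst p) (snd p)) Y)) (snd p))"
  proof (rule trace_on_finite_rank[where \<phi> = "\<lambda>p Z. B Z (snd p)"])
    show "y (fst p) *\<^sub>R br X (br (dual (fst p) (snd p)) Y) \<in> G 0" if "p \<in> ?I" for p
      using that X Y basis_even(2)[of "fst p" "snd p"] by (simp add: br_in part_closed)
    show "br X (br (rescale y Z) Y) =
        (\<Sum>p\<in>?I. B Z (snd p) *\<^sub>R y (fst p) *\<^sub>R br X (br (dual (fst p) (snd p)) Y))" for Z
      by (simp only: rescale_expansion(2) case_prod_unfold bilinear_sum_scaleR_left[OF bilinear_br]
          bilinear_sum_scaleR_right[OF bilinear_br] br_linear)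
  qed (auto intro: subspace_part finite_some_basis_subspace linear_B)
  also have "\<dots> = (\<Sum>p\<in>?I. - (y (fst p) * B X (br (snd p) (br (dual (fst p) (snd p)) Y))))"
  proof (rule sum.cong[OF refl])
    fix p assume "p \<in> ?I"
    then have "snd p \<in> G 0" "br (dual (fst p) (snd p)) Y \<in> G 1"
      using basis_even[of "fst p" "snd p"] Y by (auto intro: br_in)
    then show "B (y (fst p) *\<^sub>R br X (br (dual (fst p) (snd p)) Y)) (snd p) =
        - (y (fst p) * B X (br (snd p) (br (dual (fst p) (snd p)) Y)))"
      using br_skew_even[of "snd p"] by (simp add: B_linear B_inv)
  qed
  finally show ?thesis
    by (simp add: casimir_form_expansion case_prod_unfold sum_negf)
qed

text \<open>The diagonal terms B([[X, e], Y], d) become B(X, [e, [Y, d]]) after two uses of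
  invariance; the sign comes from the inner bracket.\<close>

lemma trace_odd_casimir:
  assumes X: "X \<in> G 1" and Y: "Y \<in> G 1"
  shows "trace_on (G 1) (\<lambda>Z. br X (rescale y (br Z Y))) = - casimir_form y X Y"
proof -
  let ?I = "SIGMA i:{..s}. some_basis (k i)"
  have "trace_on (G 1) (\<lambda>Z. br X (rescale y (br Z Y))) =
      (\<Sum>p\<in>?I. B (br (y (fst p) *\<^sub>R br X (snd p)) Y) (dual (fst p) (snd p)))"
  proof (rule trace_on_finite_rank[where \<phi> = "\<lambda>p Z. B (br Z Y) (dual (fst p) (snd p))"])
    show "linear (\<lambda>Z. B (br Z Y) (dual (fst p) (snd p)))" for p
      using linear_compose[OF linear_br(2) linear_B(2)] by (simp add: o_def)
    show "y (fst p) *\<^sub>R br X (snd p) \<in> G 1" if "p \<in> ?I" for p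
      using that X basis_even(1)[of "fst p" "snd p"] by (simp add: br_in part_closed)
    show "br X (rescale y (br Z Y)) =
        (\<Sum>p\<in>?I. B (br Z Y) (dual (fst p) (snd p)) *\<^sub>R y (fst p) *\<^sub>R br X (snd p))" for Z
      by (simp only: rescale_expansion(1) case_prod_unfold
          bilinear_sum_scaleR_right[OF bilinear_br] br_linear)
  qed (auto intro: subspace_part finite_some_basis_subspace)
  also have "\<dots> = (\<Sum>p\<in>?I. - (y (fst p) * B X (br (snd p) (br (dual (fst p) (snd p)) Y))))"
  proof (rule sum.cong[OF refl])
    fix p assume "p \<in> ?I"
    then have "dual (fst p) (snd p) \<in> G 0"
      using basis_even[of "fst p" "snd p"] by auto
    then show "B (br (y (fst p) *\<^sub>R br X (snd p)) Y) (dual (fst p) (snd p)) =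
        - (y (fst p) * B X (br (snd p) (br (dual (fst p) (snd p)) Y)))"
      using br_skew_even[OF _ Y] by (simp add: B_linear br_linear B_inv)
  qed
  finally show ?thesis
    by (simp add: casimir_form_expansion case_prod_unfold sum_negf)
qed

text \<open>The diagonal terms B([[d, Y], X], e) equal B([d, Y], [X, e]); here the sign comes from
  the antisymmetry of \<open>B\<close> on the odd part, before invariance is used once more.\<close>

lemma trace_odd_casimir':
  assumes X: "X \<in> G 1" and Y: "Y \<in> G 1"
  shows "trace_on (G 1) (\<lambda>Z. br (rescale y (br Z X)) Y) = - casimir_form y X Y"
proof -
  let ?I = "SIGMA i:{..s}. some_basis (k i)"
  have "trace_on (G 1) (\<lambda>Z. br (rescale y (br Z X)) Y) =
      (\<Sum>p\<in>?I. B (br (y (fst p) *\<^sub>R br (dual (fst p) (snd p)) Y) X) (snd p))"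
  proof (rule trace_on_finite_rank[where \<phi> = "\<lambda>p Z. B (br Z X) (snd p)"])
    show "linear (\<lambda>Z. B (br Z X) (snd p))" for p
      using linear_compose[OF linear_br(2) linear_B(2)] by (simp add: o_def)
    show "y (fst p) *\<^sub>R br (dual (fst p) (snd p)) Y \<in> G 1" if "p \<in> ?I" for p
      using that Y basis_even(2)[of "fst p" "snd p"] by (simp add: br_in part_closed)
    show "br (rescale y (br Z X)) Y =
        (\<Sum>p\<in>?I. B (br Z X) (snd p) *\<^sub>R y (fst p) *\<^sub>R br (dual (fst p) (snd p)) Y)" for Z
      by (simp only: rescale_expansion(2) case_prod_unfold
          bilinear_sum_scaleR_left[OF bilinear_br] br_linear)
  qed (auto intro: subspace_part finite_some_basis_subspace)
  also have "\<dots> = (\<Sum>p\<in>?I. - (y (fst p) * B X (br (snd p) (br (dual (fst p) (snd p)) Y))))"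
  proof (rule sum.cong[OF refl])
    fix p assume "p \<in> ?I"
    then have "snd p \<in> G 0" "dual (fst p) (snd p) \<in> G 0"
      using basis_even[of "fst p" "snd p"] by auto
    then have "B (br (dual (fst p) (snd p)) Y) (br X (snd p)) =
        - B (br X (snd p)) (br (dual (fst p) (snd p)) Y)"
      using X Y by (subst B_sym[of _ 1 _ 1]) (auto intro: br_in)
    then show "B (br (y (fst p) *\<^sub>R br (dual (fst p) (snd p)) Y) X) (snd p) =
        - (y (fst p) * B X (br (snd p) (br (dual (fst p) (snd p)) Y)))"
      using B_inv by (simp add: B_linear br_linear)
  qed
  finally show ?thesis
    by (simp add: casimir_form_expansion case_prod_unfold sum_negf)
qed

text \<open>For \<open>Y\<close> = [U, V] with \<open>U\<close>, \<open>V\<close> in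
  \<open>k j\<close>, ad X commutes with ad U, so ad X ad Y is the commutator of ad U with ad X ad V
  and has trace zero. Such brackets span the simple ideal \<open>k j\<close>.\<close>

lemma trace_odd_disjoint_simple:
  assumes ij: "i \<le> s" "j \<le> s" "i \<noteq> j" "1 \<le> j" and X: "X \<in> k i" and Y: "Y \<in> k j"
  shows "trace_on (G 1) (\<lambda>Z. br X (br Y Z)) = 0"
proof -
  have X0: "X \<in> G 0" using X k_subset ij by blast
  have G1: "br U (br V Z) \<in> G 1" if "U \<in> G 0" "V \<in> G 0" "Z \<in> G 1" for U V Z
    using that br_in by blast
  \<comment> \<open>Membership in \<open>G 0\<close> is carried through the induction so that
    additivity of the trace applies to each partial sum.\<close>
  have "trace_on (G 1) (\<lambda>Z. br X (br Y Z)) = 0 \<and> Y \<in> G 0"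
    if "Y \<in> span {br U V | U V. U \<in> k j \<and> V \<in> k j}"
    using that
  proof (induction rule: span_induct_alt)
    case base
    show ?case by (simp add: br_linear trace_on_zero subspace_part part_closed)
  next
    case (step c W Y)
    obtain U V where W: "W = br U V" and UV: "U \<in> k j" "V \<in> k j" using step(1) by blast
    have Y_zero: "trace_on (G 1) (\<lambda>Z. br X (br Y Z)) = 0" and Y0: "Y \<in> G 0"
      using step by auto
    have even: "U \<in> G 0" "V \<in> G 0" using UV k_subset ij by auto
    have W0: "W \<in> G 0" using br_in(1)[OF even] W by simp
    have comm: "br X (br U Z) = br U (br X Z)" if "Z \<in> G 1" for Z
      using br_jacobi_even[OF X0 even(1) that] br_k_disjoint[OF ij(1-3) X UV(1)]
      by (simp add: br_linear)
    have "trace_on (G 1) (\<lambda>Z. br X (br W Z)) =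
        trace_on (G 1) (\<lambda>Z. br U (br X (br V Z)) - br X (br V (br U Z)))"
    proof (intro trace_on_cong subspace_part)
      fix Z assume Z: "Z \<in> G 1"
      show "br X (br W Z) = br U (br X (br V Z)) - br X (br V (br U Z))"
        unfolding W br_jacobi_even[OF even Z] br_linear comm[OF br_in(1)[OF even(2) Z]] ..
    qed
    also have "\<dots> = trace_on (G 1) (\<lambda>Z. br U (br X (br V Z))) - trace_on (G 1) (\<lambda>Z. br X (br V (br U Z)))"
      using even X0 by (intro trace_on_diff subspace_part) (auto intro: br_in)
    also have "trace_on (G 1) (\<lambda>Z. br U (br X (br V Z))) = trace_on (G 1) (\<lambda>Z. br X (br V (br U Z)))"
      using even X0 linear_compose[OF linear_br(1)[of V] linear_br(1)[of X]]
      by (intro trace_on_commute[of "G 1" "br U" "\<lambda>Z. br X (br V Z)"])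
        (auto intro: br_in subspace_part finite_some_basis_subspace linear_br simp: o_def)
    finally have W_zero: "trace_on (G 1) (\<lambda>Z. br X (br W Z)) = 0" by simp
    have "trace_on (G 1) (\<lambda>Z. br X (br (c *\<^sub>R W + Y) Z)) =
        c * trace_on (G 1) (\<lambda>Z. br X (br W Z)) + trace_on (G 1) (\<lambda>Z. br X (br Y Z))"
      using G1[OF X0 W0] G1[OF X0 Y0]
      by (simp add: br_linear trace_on_add trace_on_scale subspace_part part_closed)
    then show ?case using W_zero Y_zero W0 Y0 by (simp add: part_closed)
  qed
  then show ?thesis using k_span ij Y by blast
qed

lemma trace_odd_disjoint:
  assumes "i \<le> s" "j \<le> s" "i \<noteq> j" "X \<in> k i" "Y \<in> k j"
  shows "trace_on (G 1) (\<lambda>Z. br X (br Y Z)) = 0"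
proof (cases "1 \<le> j")
  case True
  then show ?thesis using trace_odd_disjoint_simple assms by blast
next
  case False
  have "trace_on (G 1) (\<lambda>Z. br X (br Y Z)) = trace_on (G 1) (\<lambda>Z. br Y (br X Z))"
    using k_subset[OF assms(1,4)] k_subset[OF assms(2,5)]
    by (intro trace_on_commute subspace_part finite_some_basis_subspace linear_br br_in)
  also have "\<dots> = 0"
    using trace_odd_disjoint_simple[of j i Y X] assms False by auto
  finally show ?thesis .
qed

lemma center:
  assumes "X \<in> k 0" "Z \<in> G 0"
  shows "br X Z = 0"
proof -
  have "br X (proj i Z) = 0" if "i \<le> s" for i
    using that assms abelian br_k_disjoint[of 0 i X "proj i Z"] proj_in[of i Z]
    by (cases "i = 0") (auto simp: abelian_lie_def)
  moreover have "br X Z = (\<Sum>i\<le>s. br X (proj i Z))"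
    using proj_sum[of Z] assms by (simp add: linear_sum[OF linear_br(1), symmetric] part_of_homogeneous)
  ultimately show ?thesis by simp
qed

text \<open>ad Y vanishes on the even part, so only the odd block remains, with the minus sign of
  the supertrace.\<close>

lemma super_killing_center:
  assumes X: "X \<in> k 0" and Y: "Y \<in> k 0"
  shows "super_killing G br X Y = - trace_on (G 1) (\<lambda>Z. br X (br Y Z))"
proof -
  have even: "X \<in> G 0" "Y \<in> G 0" using X Y k_subset by auto
  have "trace_on (G 0) (\<lambda>Z. part G 0 (br X (br Y Z))) = 0"
    using center[OF Y] by (intro trace_on_zero subspace_part) (simp add: br_linear linear_0[OF linear_part])
  moreover have "trace_on (G 1) (\<lambda>Z. part G 1 (br X (br Y Z))) = trace_on (G 1) (\<lambda>Z. br X (br Y Z))"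
  proof (intro trace_on_cong subspace_part)
    fix Z assume "Z \<in> G 1"
    then have "br X (br Y Z) \<in> G 1" using br_in(1)[OF even(1) br_in(1)[OF even(2)]] by blast
    then show "part G 1 (br X (br Y Z)) = br X (br Y Z)" by (simp add: part_of_homogeneous)
  qed
  ultimately show ?thesis by (simp add: super_killing_def supertrace_def)
qed

text \<open>The product maps \<open>G 0\<close> into the ideal \<open>k i\<close>, so its trace is
  already taken there; cyclicity then exchanges the two factors.\<close>

lemma trace_even_lie_killing:
  assumes i: "i \<le> s" and X: "X \<in> k i" and Y: "Y \<in> k i"
  shows "trace_on (G 0) (\<lambda>Z. br Y (br X Z)) = lie_killing br (k i) X Y"
proof -
  have even: "X \<in> G 0" "Y \<in> G 0" using X Y k_subset[OF i] by auto
  have "trace_on (G 0) (\<lambda>Z. br Y (br X Z)) = trace_on (k i) (\<lambda>Z. br Y (br X Z))"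
    using linear_compose[OF linear_br(1)[of X] linear_br(1)[of Y]] br_k[OF i] X even k_subset[OF i]
    by (intro trace_on_subspace subspace_part finite_some_basis_subspace subspace_k[OF i])
      (auto simp: o_def)
  also have "\<dots> = trace_on (k i) (\<lambda>Z. br X (br Y Z))"
    using br_k(1)[OF i] even
    by (intro trace_on_commute finite_some_basis_subspace subspace_k[OF i] linear_br) auto
  finally show ?thesis by (simp add: lie_killing_def)
qed

end

section \<open>The Ricci tensor case by case\<close>

context deformed_bi_invariant_metric
begin

text \<open>The two trace-free terms drop out. With \<open>?y\<close> the weights of
  \<open>S\<close>, the even block contributes -1/2 and the odd block -3/2 times the Casimir form of
  \<open>?y\<close>, the latter plus the form of weight 1. The supertrace subtracts the odd
  block.\<close>

lemma ricci_odd: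
  assumes X: "X \<in> G 1" and Y: "Y \<in> G 1"
  shows "ric X Y = (\<Sum>i\<le>s. (x i / 2 - 1) * B X (casimir br B (k i) Y))"
proof -
  let ?y = "\<lambda>i. x i / 2"
  have XY: "br X Y \<in> G 0" using br_in(3)[OF X Y] .
  have even: "curvature G br f Z X Y =
      (1 / 4) *\<^sub>R br (br X Y) Z + (1 / 2) *\<^sub>R br X (br (S Z) Y)" if Z: "Z \<in> G 0" for Z
  proof -
    \<comment> \<open>The Jacobi identity makes the terms [X, [Z, Y]] free of \<open>S\<close>
      cancel.\<close>
    have "br Z (br X Y) = - br (br X Y) Z" "br (br Z X) Y = br Z (br X Y) - br X (br Z Y)"
      using br_skew_even[OF XY Z] br_jacobi_even[OF Z X Y] by auto
    then show ?thesis
      using X Y Z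
      by (simp add: curvature_conn[OF Z X] conn_homogeneous br_in br_linear part_closed rescale_in)
        (simp add: algebra_simps flip: scaleR_left_distrib)
  qed
  \<comment> \<open>The even vector [Z, X] is written with weight 1 so that
    \<open>trace_odd_casimir'\<close> also evaluates the term without \<open>S\<close>.\<close>
  have odd: "curvature G br f Z X Y =
      - ((1 / 2) *\<^sub>R br (S (br X Y)) Z) + (1 / 2) *\<^sub>R br X (S (br Z Y))
      - br (rescale (\<lambda>_. 1) (br Z X)) Y + br (S (br Z X)) Y" if Z: "Z \<in> G 1" for Z
  proof -
    have "br Z (S (br X Y)) = - br (S (br X Y)) Z"
      using br_skew_even[OF rescale_in Z] .
    moreover have "part G 0 (br Z X) = br Z X"
      using part_of_homogeneous[OF br_in(3)[OF Z X]] by simp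
    ultimately show ?thesis
      using X Y Z
      by (simp add: curvature_conn[OF Z X] conn_homogeneous br_in br_linear rescale_in
          rescale_linear rescale_one part_of_homogeneous part_closed)
  qed
  have "trace_on (G 0) (\<lambda>Z. curvature G br f Z X Y) =
      trace_on (G 0) (\<lambda>Z. (1 / 4) *\<^sub>R br (br X Y) Z + (1 / 2) *\<^sub>R br X (br (S Z) Y))"
    by (intro trace_on_cong subspace_part even)
  also have "\<dots> = (1 / 4) * trace_on (G 0) (br (br X Y)) + (1 / 2) * trace_on (G 0) (\<lambda>Z. br X (br (S Z) Y))"
    using X Y XY by (simp add: trace_on_add trace_on_scale subspace_part part_closed br_in rescale_in)
  also have "\<dots> = - (1 / 2) * casimir_form ?y X Y"
    using XY by (simp add: trace_ad_even trace_even_casimir[OF X Y])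
  finally have tr0: "trace_on (G 0) (\<lambda>Z. curvature G br f Z X Y) = - (1 / 2) * casimir_form ?y X Y" .
  have "trace_on (G 1) (\<lambda>Z. curvature G br f Z X Y) =
      trace_on (G 1) (\<lambda>Z. (- (1 / 2)) *\<^sub>R br (S (br X Y)) Z + (1 / 2) *\<^sub>R br X (S (br Z Y))
        - br (rescale (\<lambda>_. 1) (br Z X)) Y + br (S (br Z X)) Y)"
    by (intro trace_on_cong subspace_part) (simp add: odd)
  also have "\<dots> = (- (1 / 2)) * trace_on (G 1) (br (S (br X Y)))
      + (1 / 2) * trace_on (G 1) (\<lambda>Z. br X (S (br Z Y)))
      - trace_on (G 1) (\<lambda>Z. br (rescale (\<lambda>_. 1) (br Z X)) Y)
      + trace_on (G 1) (\<lambda>Z. br (S (br Z X)) Y)"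
    using X Y
    by (simp add: trace_on_add trace_on_diff trace_on_scale subspace_part part_closed br_in rescale_in
        del: scaleR_minus_left)
  also have "\<dots> = - (3 / 2) * casimir_form ?y X Y + casimir_form (\<lambda>_. 1) X Y"
    by (simp add: trace_ad_even rescale_in trace_odd_casimir[OF X Y] trace_odd_casimir'[OF X Y])
  finally have "ric X Y = casimir_form ?y X Y - casimir_form (\<lambda>_. 1) X Y"
    using tr0 by (simp add: ricci_conn[OF X Y])
  then show ?thesis
    by (simp add: casimir_form_def sum_subtractf left_diff_distrib)
qed

lemma ricci_k:
  assumes "i \<le> s" "j \<le> s" and X: "X \<in> k i" and Y: "Y \<in> k j"
  shows "ric X Y = - (1 / 4) * trace_on (G 0) (\<lambda>Z. br Y (br X Z))
    + x i * x j / 4 * trace_on (G 1) (\<lambda>Z. br X (br Y Z))"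
proof -
  have even: "X \<in> G 0" "Y \<in> G 0" using assms k_subset by auto
  have "trace_on (G 1) (\<lambda>Z. br (S X) (br (S Y) Z)) =
      trace_on (G 1) (\<lambda>Z. (x i * x j / 4) *\<^sub>R br X (br Y Z))"
    using assms by (simp add: rescale_k br_linear mult.commute)
  also have "\<dots> = x i * x j / 4 * trace_on (G 1) (\<lambda>Z. br X (br Y Z))"
    using even by (intro trace_on_scale subspace_part) (auto intro: br_in)
  finally show ?thesis using ricci_even[OF even] by simp
qed

text \<open>On the even part ad X has values in \<open>k i\<close>, which ad Y annihilates; on the
  odd part the trace vanishes by \<open>trace_odd_disjoint\<close>.\<close>

lemma ricci_k_disjoint:
  assumes ij: "i \<le> s" "j \<le> s" "i \<noteq> j" and X: "X \<in> k i" and Y: "Y \<in> k j"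
  shows "ric X Y = 0"
proof -
  have "trace_on (G 0) (\<lambda>Z. br Y (br X Z)) = 0"
    using ij X Y br_k br_k_disjoint[of j i Y] by (intro trace_on_zero subspace_part) auto
  then show ?thesis
    using trace_odd_disjoint[OF ij X Y] by (simp add: ricci_k[OF ij(1,2) X Y])
qed

lemma ricci_center:
  assumes X: "X \<in> k 0" and Y: "Y \<in> k 0"
  shows "ric X Y = - ((x 0)\<^sup>2 / 4) * super_killing G br X Y"
proof -
  have "trace_on (G 0) (\<lambda>Z. br Y (br X Z)) = 0"
    using center[OF X] by (intro trace_on_zero subspace_part) (simp add: br_linear)
  then show ?thesis
    using ricci_k[OF _ _ X Y] by (simp add: super_killing_center[OF X Y] power2_eq_square)
qed

lemma ricci_simple:
  assumes i: "i \<le> s" and l: "is_index G br (k i) l" and X: "X \<in> k i" and Y: "Y \<in> k i"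
  shows "ric X Y = 1 / 4 * (l * (x i)\<^sup>2 - 1) * lie_killing br (k i) X Y"
proof -
  have "trace_on (G 1) (\<lambda>Z. br X (br Y Z)) = l * lie_killing br (k i) X Y"
    using l X Y by (simp add: is_index_def)
  then show ?thesis
    by (simp add: ricci_k[OF i i X Y] trace_even_lie_killing[OF i X Y] power2_eq_square algebra_simps)
qed

end

theorem proposition3p8:
  fixes G :: "bit \<Rightarrow> 'a::real_vector set"
    and br :: "'a \<Rightarrow> 'a \<Rightarrow> 'a"
    and B :: "'a \<Rightarrow> 'a \<Rightarrow> real"
    and s :: nat
    and k :: "nat \<Rightarrow> 'a set"
    and x l :: "nat \<Rightarrow> real"
  defines "ric \<equiv> ricci G br (deformed_metric G B s k x)"
  assumes "lie_superalgebra G br"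
    and "reductive_lie br (G 0)"
    and "direct_sum {..s} k (G 0)"
    and "\<forall>i\<le>s. lie_ideal br (G 0) (k i)"
    and "abelian_lie br (k 0)"
    and "\<forall>i\<in>{1..s}. simple_lie br (k i)"
    and "super_metric G B" and "bi_invariant br B"
    and "\<forall>i\<le>s. x i \<noteq> 0"
    and "\<forall>i\<in>{1..s}. is_index G br (k i) (l i)"
  shows "(\<forall>X\<in>k 0. \<forall>Y\<in>k 0. ric X Y = - ((x 0)\<^sup>2 / 4) * super_killing G br X Y) \<and>
    (\<forall>i\<in>{1..s}. \<forall>X\<in>k i. \<forall>Y\<in>k i.
       ric X Y = 1 / 4 * (l i * (x i)\<^sup>2 - 1) * lie_killing br (k i) X Y) \<and>
    (\<forall>X\<in>G 1. \<forall>Y\<in>G 1.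
       ric X Y = (\<Sum>i=0..s. (x i / 2 - 1) * B X (casimir br B (k i) Y))) \<and>
    (\<forall>i\<le>s. \<forall>j\<le>s. i \<noteq> j \<longrightarrow> (\<forall>X\<in>k i. \<forall>Y\<in>k j. ric X Y = 0)) \<and>
    (\<forall>i\<le>s. \<forall>X\<in>k i. \<forall>Y\<in>G 1. ric X Y = 0 \<and> ric Y X = 0)"
proof -
  interpret lie_superalgebra G br by fact
  interpret deformed_bi_invariant_metric G br B s k x
    using assms by unfold_locales auto
  \<comment> \<open>Arguments of different parity are settled in both orders by evenness of the
    Ricci tensor.\<close>
  have "ric X Y = 0" "ric Y X = 0" if "i \<le> s" "X \<in> k i" "Y \<in> G 1" for i X Y
    using ricci_mixed[OF super_metric_deformed is_levi_civita_conn] k_subset[OF that(1,2)] that(3)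
    unfolding ric_def by (metis zero_neq_one)+
  then show ?thesis
    using assms(11) ricci_center ricci_simple ricci_odd ricci_k_disjoint
    unfolding ric_def atMost_atLeast0[symmetric] by (auto simp del: One_nat_def)
qed

end
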